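(* Let $P$ be a triangular patch on a smooth oriented surface $S$ in $\mathbb{R}^3$, and let $1\le m\le l$ be integers. Let $\tilde\alpha^{(l,m)}$ be the complex-quaternion-valued 2-form (in $\boldsymbol r$) $$\tilde\alpha^{(l,m)}(\boldsymbol r',\boldsymbol r)=(0,\nabla G(\boldsymbol r',\boldsymbol r))(0,\boldsymbol\nu(\boldsymbol r))(0,\nabla S^{(l,m)}(\boldsymbol r))\,da(\boldsymbol r).$$ Suppose that the complex differential 1-forms $\tilde\beta^{(l,m)}$ are defined by $$\tilde\beta^{(l,m)}(\boldsymbol r',\boldsymbol r)=\frac{1}{4\pi}\sum_{j=2}^l C_{j,l}\sum_{k=-j}^j q^{(j,k)}(\boldsymbol r',\boldsymbol r)\,S^{(l-j,m-k)}(\boldsymbol r')\,T_{jk,lm},$$ where $$C_{j,l}=\int_0^1 t^{j-2}(1-t)^{l-j}\,dt=\frac{(j-2)!\,(l-j)!}{(l-1)!},$$ and the quaternion 1-forms $q^{(j,k)}$ are given by $$q^{(j,k)}(\boldsymbol r',\boldsymbol r)=-\left(0,d\left(\frac{\boldsymbol r'-\boldsymbol r}{|\boldsymbol r'-\boldsymbol r|}\right)\right)\left(0,\nabla S^{(j,k)}(\boldsymbol r)\right).$$ Suppose further that $$\gamma^{(l,m)}(\boldsymbol r',\boldsymbol r)=\frac{1}{4\pi}\,\omega(\boldsymbol r',\boldsymbol r)\,(0,\nabla S^{(l,m)}(\boldsymbol r')),$$ where $\omega=(\omega_0,\boldsymbol\omega)$ is the quaternion 1-form defined by $$\omega_0(\boldsymbol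 r',\boldsymbol r)=\frac{((\boldsymbol r'-\boldsymbol r)\times\boldsymbol u)\cdot d\boldsymbol r}{|\boldsymbol r'-\boldsymbol r|\left(|\boldsymbol r'-\boldsymbol r|+\boldsymbol u\cdot(\boldsymbol r'-\boldsymbol r)\right)},\qquad \boldsymbol\omega(\boldsymbol r',\boldsymbol r)=-\frac{d\boldsymbol r}{|\boldsymbol r'-\boldsymbol r|},$$ with $\boldsymbol u$ a fixed unit vector such that $(\boldsymbol r'-\boldsymbol r)\cdot\boldsymbol u\ge 0$ for any $\boldsymbol r\in P$. Then $$d\left(\tilde\beta^{(l,m)}(\boldsymbol r',\boldsymbol r)+\gamma^{(l,m)}(\boldsymbol r',\boldsymbol r)\right)=\tilde\alpha^{(l,m)}(\boldsymbol r',\boldsymbol r).$$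
   Context: Kernel: $G(\boldsymbol r',\boldsymbol r)=\dfrac{1}{4\pi|\boldsymbol r'-\boldsymbol r|}$, the Laplace Green's function. The target point $\boldsymbol r'\in\mathbb{R}^3$ is fixed; $\nabla G$ and the exterior derivative $d$ are with respect to the source point $\boldsymbol r=(x,y,z)$, while $\nabla S^{(l,m)}(\boldsymbol r')$ is the gradient of the polynomial $S^{(l,m)}$ evaluated at $\boldsymbol r'$. Area form: $\boldsymbol\nu(\boldsymbol r)$ is the unit normal and $da(\boldsymbol r)$ the area element; $\boldsymbol\nu(\boldsymbol r)\,da(\boldsymbol r)$ is identified with the vector-valued 2-form $(dy\wedge dz,\ dz\wedge dx,\ dx\wedge dy)$. $d\boldsymbol r=(dx,dy,dz)$. Quaternions: a quaternion with scalar part $f_0$ and vector part $\boldsymbol f$ is written $(f_0,\boldsymbol f)$, with product $fg=(f_0g_0-\boldsymbol f\cdot\boldsymbol g,\ f_0\boldsymbol g+g_0\boldsymbol f+\boldsymbol f\times\boldsymbol g)$; complex components are allowed, with $\cdot$ and $\times$ extended complex-bilinearly. Exterior differentiation of quaternion-valued forms is componentwise. Solid harmonics: for $l\ge0$, $-l\le m\le l$, let $P_l^m(x)=\frac{1}{2^l l!}(1-x^2)^{m/2}\frac{d^{l+m}}{dx^{l+m}}(x^2-1)^l$ and $$R_l^m(\boldsymbol r)=\sqrt{\frac{(l-m)!}{(l+m)!}}\;r^l P_l^m(\cos\theta)e^{im\phi},$$ where $(r,\theta,\phi)$ are the spherical coordinates of $\boldsymbol r$ ($\theta$ the polar angle from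 the $z$-axis); $R_l^m$ is a homogeneous harmonic polynomial of degree $l$ in $(x,y,z)$. Set $S^{(l,m)}(x,y,z)=R_l^m(y,z,x)$, and $$T_{jk,lm}=\binom{l+m}{j+k}^{1/2}\binom{l-m}{j-k}^{1/2},$$ where binomial coefficients outside the usual range are zero (so terms with $|m-k|>l-j$ vanish).
   Formalization: The numerator of ω₀ is taken as (u×(r'−r))·dr instead of ((r'−r)×u)·dr, because with the printed sign dω₀ has the wrong sign and the identity fails already for l=m=1; the identity is asserted at points r≠r' of P. *)

theory Defs
  imports "HOL-Analysis.Analysis"
begin

section \<open>Complexified quaternions\<close>

text \<open>
  A pair \<open>(f0, f)\<close> is the quaternion with scalar part \<open>f0\<close> and vector part \<open>f\<close>. The dot product is
  complex bilinear, so it is not the (real, conjugating) inner product of the type class.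
\<close>

type_synonym cquat = "complex \<times> (complex^3)"

definition cdot :: "complex^3 \<Rightarrow> complex^3 \<Rightarrow> complex" where
  "cdot a b = (\<Sum>i\<in>UNIV. a $ i * b $ i)"

definition ccross :: "complex^3 \<Rightarrow> complex^3 \<Rightarrow> complex^3" where
  "ccross a b = vector [a$2 * b$3 - a$3 * b$2, a$3 * b$1 - a$1 * b$3, a$1 * b$2 - a$2 * b$1]"

definition qmult :: "cquat \<Rightarrow> cquat \<Rightarrow> cquat" (infixl \<open>\<otimes>\<^sub>q\<close> 70) where
  "f \<otimes>\<^sub>q g = (fst f * fst g - cdot (snd f) (snd g),
             fst f *s snd g + fst g *s snd f + ccross (snd f) (snd g))"

definition qscale :: "complex \<Rightarrow> cquat \<Rightarrow> cquat" (infixr \<open>*\<^sub>q\<close> 75) where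
  "c *\<^sub>q f = (c * fst f, c *s snd f)"

definition qvec :: "complex^3 \<Rightarrow> cquat" where
  "qvec f = (0, f)"

definition cvec :: "real^3 \<Rightarrow> complex^3" where
  "cvec v = (\<chi> i. complex_of_real (v $ i))"


section \<open>Differential forms on three-space\<close>

text \<open>
  A form takes the base point first and then its tangent vectors. Two-forms are normalised by
  \<open>(\<alpha> \<and> \<beta>)(v, w) = \<alpha>(v) \<beta>(w) - \<alpha>(w) \<beta>(v)\<close>, without a factor 1/2. Forms may take values in any
  real normed space; for product and vector types the exterior derivative then acts componentwise.
\<close>

type_synonym 'v form1 = "real^3 \<Rightarrow> real^3 \<Rightarrow> 'v"
type_synonym 'v form2 = "real^3 \<Rightarrow> real^3 \<Rightarrow> real^3 \<Rightarrow> 'v"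

definition ext_deriv0 :: "(real^3 \<Rightarrow> 'v::real_normed_vector) \<Rightarrow> 'v form1" where
  "ext_deriv0 f r v = frechet_derivative f (at r) v"

definition ext_deriv1 :: "'v::real_normed_vector form1 \<Rightarrow> 'v form2" where
  "ext_deriv1 \<beta> r v w =
     frechet_derivative (\<lambda>s. \<beta> s w) (at r) v - frechet_derivative (\<lambda>s. \<beta> s v) (at r) w"

definition form1_differentiable_at :: "'v::real_normed_vector form1 \<Rightarrow> real^3 \<Rightarrow> bool" where
  "form1_differentiable_at \<beta> r \<longleftrightarrow> (\<forall>v. (\<lambda>s. \<beta> s v) differentiable (at r))"

definition coord_form :: "3 \<Rightarrow> real form1" where
  "coord_form i r v = v $ i"

definition wedge :: "real form1 \<Rightarrow> real form1 \<Rightarrow> real form2" where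
  "wedge \<alpha> \<beta> r v w = \<alpha> r v * \<beta> r w - \<alpha> r w * \<beta> r v"

definition dr_form :: "(real^3) form1" where
  "dr_form r v = (\<chi> i. coord_form i r v)"

text \<open>The vector-valued two-form \<open>(dy \<and> dz, dz \<and> dx, dx \<and> dy)\<close>, identified with \<open>\<nu> da\<close>.\<close>

definition nu_da :: "(real^3) form2" where
  "nu_da r v w = vector [wedge (coord_form 2) (coord_form 3) r v w,
                         wedge (coord_form 3) (coord_form 1) r v w,
                         wedge (coord_form 1) (coord_form 2) r v w]"

text \<open>On tangent vectors of a surface with unit normal \<open>n\<close> it is indeed normal times signed area.\<close>

lemma nu_da_tangent:
  assumes "norm n = 1" "n \<bullet> v = 0" "n \<bullet> w = 0"
  shows "nu_da r v w = (n \<bullet> cross3 v w) *\<^sub>R n"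
proof -
  have eq: "nu_da r v w = cross3 v w"
    by (simp add: nu_da_def wedge_def coord_form_def cross3_def mult.commute)
  have "cross3 n (cross3 v w) = 0"
    using assms by (simp add: Lagrange)
  then have "cross3 n (cross3 n (cross3 v w)) = 0"
    by (simp add: cross3_def vec_eq_iff forall_3)
  then have "(n \<bullet> cross3 v w) *\<^sub>R n - (n \<bullet> n) *\<^sub>R cross3 v w = 0"
    by (simp only: Lagrange[of n n "cross3 v w"])
  moreover have "n \<bullet> n = 1"
    using assms(1) by (simp add: norm_eq_1)
  ultimately show ?thesis
    using eq by simp
qed

text \<open>The gradient, for real-valued as well as for complex-valued functions.\<close>

definition grad :: "(real^3 \<Rightarrow> 'v::real_normed_vector) \<Rightarrow> real^3 \<Rightarrow> 'v^3" where
  "grad f r = (\<chi> i. frechet_derivative f (at r) (axis i 1))"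


section \<open>Smooth oriented surfaces and triangular patches\<close>

fun Ck_on :: "nat \<Rightarrow> ('a::euclidean_space \<Rightarrow> 'b::real_normed_vector) \<Rightarrow> 'a set \<Rightarrow> bool" where
  "Ck_on 0 f U = continuous_on U f"
| "Ck_on (Suc k) f U =
     ((\<forall>x\<in>U. f differentiable (at x)) \<and> (\<forall>v. Ck_on k (\<lambda>x. frechet_derivative f (at x) v) U))"

definition smooth_on :: "('a::euclidean_space \<Rightarrow> 'b::real_normed_vector) \<Rightarrow> 'a set \<Rightarrow> bool" where
  "smooth_on f U \<longleftrightarrow> (\<forall>k. Ck_on k f U)"

text \<open>An embedded surface, oriented by a continuous unit normal field \<open>\<nu>\<close>.\<close>

definition smooth_oriented_surface :: "(real^3) set \<Rightarrow> (real^3 \<Rightarrow> real^3) \<Rightarrow> bool" where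
  "smooth_oriented_surface S \<nu> \<longleftrightarrow>
     continuous_on S \<nu> \<and> (\<forall>p\<in>S. norm (\<nu> p) = 1) \<and>
     (\<forall>p\<in>S. \<exists>W (U :: (real^2) set) \<phi> \<psi>.
        open W \<and> p \<in> W \<and> open U \<and> homeomorphism U (S \<inter> W) \<phi> \<psi> \<and> smooth_on \<phi> U \<and>
        (\<forall>x\<in>U. inj (frechet_derivative \<phi> (at x)) \<and>
               (\<forall>h. \<nu> (\<phi> x) \<bullet> frechet_derivative \<phi> (at x) h = 0)))"

definition std_triangle :: "(real^2) set" where
  "std_triangle = {x. 0 \<le> x $ 1 \<and> 0 \<le> x $ 2 \<and> x $ 1 + x $ 2 \<le> 1}"

definition triangular_patch :: "(real^3) set \<Rightarrow> (real^3) set \<Rightarrow> bool" where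
  "triangular_patch P S \<longleftrightarrow>
     (\<exists>V \<tau>. open V \<and> std_triangle \<subseteq> V \<and> smooth_on \<tau> V \<and> inj_on \<tau> std_triangle \<and>
        (\<forall>x\<in>std_triangle. inj (frechet_derivative \<tau> (at x))) \<and>
        \<tau> ` std_triangle = P \<and> P \<subseteq> S)"


section \<open>Solid harmonics\<close>

text \<open>
  The factor \<open>(1 - x\<^sup>2)\<close> to the power \<open>m/2\<close> is written as an integer power of the square root, so that
  it is 1 at the poles for \<open>m = 0\<close>; for \<open>m < 0\<close> it is 0 there, the limit of the Legendre function.
\<close>

definition assoc_legendre :: "nat \<Rightarrow> int \<Rightarrow> real \<Rightarrow> real" where
  "assoc_legendre l m x =
     1 / (2^l * fact l) * sqrt (1 - x^2) powi m
       * (deriv ^^ nat (int l + m)) (\<lambda>t. (t^2 - 1)^l) x"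

text \<open>
  Spherical coordinates are \<open>r = norm p\<close>, \<open>cos \<theta> = z / r\<close> and \<open>\<phi> = Arg (x + i y)\<close>. Where these are
  ambiguous (on the z-axis) the totality conventions \<open>Arg 0 = 0\<close> and \<open>x / 0 = 0\<close> give the values of
  the polynomial. Only \<open>-l \<le> m \<le> l\<close> is meaningful.
\<close>

definition solid_R :: "nat \<Rightarrow> int \<Rightarrow> real^3 \<Rightarrow> complex" where
  "solid_R l m p =
     complex_of_real (sqrt (fact (nat (int l - m)) / fact (nat (int l + m))) * norm p ^ l
                        * assoc_legendre l m (p $ 3 / norm p))
       * exp (\<i> * of_int m * complex_of_real (Arg (Complex (p $ 1) (p $ 2))))"

definition solid_S :: "nat \<Rightarrow> int \<Rightarrow> real^3 \<Rightarrow> complex" where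
  "solid_S l m p = solid_R l m (vector [p $ 2, p $ 3, p $ 1])"

definition binom_int :: "int \<Rightarrow> int \<Rightarrow> real" where
  "binom_int n k = (if 0 \<le> k \<and> k \<le> n then real (nat n choose nat k) else 0)"

definition T_coeff :: "nat \<Rightarrow> int \<Rightarrow> nat \<Rightarrow> int \<Rightarrow> real" where
  "T_coeff j k l m =
     sqrt (binom_int (int l + m) (int j + k)) * sqrt (binom_int (int l - m) (int j - k))"

definition C_coeff :: "nat \<Rightarrow> nat \<Rightarrow> real" where
  "C_coeff j l = integral {0..1} (\<lambda>t. t ^ (j - 2) * (1 - t) ^ (l - j))"

lemma C_coeff_eq:
  assumes "2 \<le> j" "j \<le> l"
  shows "C_coeff j l = fact (j - 2) * fact (l - j) / fact (l - 1)"
proof -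
  define a b where "a = j - 2" and "b = l - j"
  have "((\<lambda>t. t powr (real (Suc a) - 1) * (1 - t) powr (real (Suc b) - 1))
          has_integral Beta (real (Suc a)) (real (Suc b))) {0<..<1}"
    using has_integral_Beta_real[of "real (Suc a)" "real (Suc b)"]
    by (simp add: has_integral_Icc_iff_Ioo)
  then have "((\<lambda>t. t ^ a * (1 - t) ^ b) has_integral Beta (real (Suc a)) (real (Suc b))) {0<..<1::real}"
    by (rule has_integral_eq[rotated]) (auto simp: powr_realpow)
  then have "integral {0..1} (\<lambda>t::real. t ^ a * (1 - t) ^ b) = Beta (real (Suc a)) (real (Suc b))"
    by (simp add: has_integral_Icc_iff_Ioo integral_unique)
  also have "\<dots> = fact a * fact b / fact (a + b + 1)"
  proof -
    have "Gamma (real (Suc a)) = fact a" "Gamma (real (Suc b)) = fact b"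
      "Gamma (real (Suc a) + real (Suc b)) = fact (a + b + 1)"
      using Gamma_fact[of a, where ?'a = real] Gamma_fact[of b, where ?'a = real]
        Gamma_fact[of "a + b + 1", where ?'a = real]
      by (simp_all add: algebra_simps)
    then show ?thesis by (simp only: Beta_def)
  qed
  also have "a + b + 1 = l - 1"
    using assms by (simp add: a_def b_def)
  finally show ?thesis
    by (simp add: C_coeff_def a_def b_def)
qed


section \<open>The kernel and the forms\<close>

definition Green :: "real^3 \<Rightarrow> real^3 \<Rightarrow> real" where
  "Green r' r = 1 / (4 * pi * norm (r' - r))"

definition alpha_form :: "nat \<Rightarrow> int \<Rightarrow> real^3 \<Rightarrow> cquat form2" where
  "alpha_form l m r' r v w =
     qvec (cvec (grad (Green r') r)) \<otimes>\<^sub>q qvec (cvec (nu_da r v w)) \<otimes>\<^sub>q qvec (grad (solid_S l m) r)"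

definition q_form :: "nat \<Rightarrow> int \<Rightarrow> real^3 \<Rightarrow> cquat form1" where
  "q_form j k r' r v =
     - (qvec (cvec (ext_deriv0 (\<lambda>s. (r' - s) /\<^sub>R norm (r' - s)) r v)) \<otimes>\<^sub>q qvec (grad (solid_S j k) r))"

definition beta_form :: "nat \<Rightarrow> int \<Rightarrow> real^3 \<Rightarrow> cquat form1" where
  "beta_form l m r' r v =
     complex_of_real (1 / (4 * pi)) *\<^sub>q
       (\<Sum>j = 2..l. complex_of_real (C_coeff j l) *\<^sub>q
          (\<Sum>k = - int j..int j.
             (solid_S (l - j) (m - k) r' * complex_of_real (T_coeff j k l m)) *\<^sub>q q_form j k r' r v))"

text \<open>
  The cross product is \<open>u \<times> (r' - r)\<close>. The source prints \<open>(r' - r) \<times> u\<close>, a sign slip: with its own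
  conventions, \<open>d\<close> of the scalar part is then \<open>+ (r' - r) \<bullet> \<nu> da / |r' - r|\<^sup>3\<close>, whereas the scalar
  part of \<open>4\<pi> (0, \<nabla>G) (0, \<nu>) da\<close> is \<open>- (r' - r) \<bullet> \<nu> da / |r' - r|\<^sup>3\<close>, and the identity
  \<open>d(\<beta> + \<gamma>) = \<alpha>\<close> already fails for \<open>l = m = 1\<close>, where the sum defining \<open>\<beta>\<close> is empty. The vector
  part of \<open>\<omega>\<close> needs no change.
\<close>

definition omega0_form :: "real^3 \<Rightarrow> real^3 \<Rightarrow> real form1" where
  "omega0_form u r' r v =
     (cross3 u (r' - r) \<bullet> dr_form r v) / (norm (r' - r) * (norm (r' - r) + u \<bullet> (r' - r)))"

definition omega_vec_form :: "real^3 \<Rightarrow> (real^3) form1" where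
  "omega_vec_form r' r v = - (dr_form r v /\<^sub>R norm (r' - r))"

definition omega_form :: "real^3 \<Rightarrow> real^3 \<Rightarrow> cquat form1" where
  "omega_form u r' r v = (complex_of_real (omega0_form u r' r v), cvec (omega_vec_form r' r v))"

definition gamma_form :: "nat \<Rightarrow> int \<Rightarrow> real^3 \<Rightarrow> real^3 \<Rightarrow> cquat form1" where
  "gamma_form l m u r' r v =
     complex_of_real (1 / (4 * pi)) *\<^sub>q (omega_form u r' r v \<otimes>\<^sub>q qvec (grad (solid_S l m) r'))"

end

theory Submission
  imports Defs
begin

text \<open>
  Up to a constant, the solid harmonic \<open>S(p)\<close> of degree \<open>l\<close> and order \<open>m\<close> is the coefficient of \<open>s ^ (l + m)\<close> in
  \<open>Q(p) ^ l\<close>, where the quadratic polynomial \<open>Q(p)\<close> in \<open>s\<close> (\<open>null_poly p\<close> below) is linear in \<open>p\<close>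
  and isotropic, \<open>\<Sum>\<^sub>i Q(e\<^sub>i)\<^sup>2 = 0\<close>. So the inner sums of \<open>\<beta>\<close> are products of powers of \<open>Q(r')\<close> and \<open>Q(r)\<close>,
  and \<open>\<beta> = - (0, dA) (0, F) / 4\<pi>\<close> with \<open>A = (r' - r) / |r' - r|\<close>, where the Jacobian \<open>M\<close> of \<open>F\<close> is symmetric and
  traceless (isotropy) and \<open>M (r - r') = \<nabla>S(r) - \<nabla>S(r')\<close> (a geometric sum). For such \<open>M\<close>, \<open>dA \<and> (M dr)\<close> equals
  \<open>4\<pi> (0, \<nabla>G) (0, \<nu> da) (0, M (r - r'))\<close>, which is \<open>\<alpha>\<close> up to the contribution of the constant \<open>\<nabla>S(r')\<close>.
  That contribution is \<open>d\<gamma>\<close>, as \<open>d\<omega> = 4\<pi> (0, \<nabla>G) (0, \<nu> da)\<close>.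
\<close>

section \<open>Quaternion algebra\<close>

lemma qmult_qvec: "qvec a \<otimes>\<^sub>q qvec b = (- cdot a b, ccross a b)"
  by (simp add: qmult_def qvec_def)

lemma cdot_3: "cdot a b = a$1 * b$1 + a$2 * b$2 + a$3 * b$3"
  by (simp add: cdot_def sum_3)

lemma bilinear_qmult: "bilinear (\<otimes>\<^sub>q)"
  by (auto simp: bilinear_def linear_iff qmult_def prod_eq_iff cdot_3 ccross_def vec_eq_iff forall_3
      scaleR_conv_of_real[where 'a=complex] algebra_simps)

lemma bounded_bilinear_qmult: "bounded_bilinear (\<otimes>\<^sub>q)"
  using bilinear_qmult by (simp only: bilinear_conv_bounded_bilinear)

interpretation qmult: bounded_bilinear "(\<otimes>\<^sub>q)"
  by (rule bounded_bilinear_qmult)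

lemma qscale_of_real: "complex_of_real c *\<^sub>q f = c *\<^sub>R f"
  by (auto simp: qscale_def prod_eq_iff vec_eq_iff scaleR_conv_of_real[where 'a=complex])

lemma qscale_qmult_qvec: "c *\<^sub>q (qvec a \<otimes>\<^sub>q qvec b) = qvec a \<otimes>\<^sub>q qvec (c *s b)"
  by (simp add: qmult_qvec qscale_def cdot_3 ccross_def vec_eq_iff forall_3 algebra_simps)

lemma bounded_linear_cvec: "bounded_linear cvec"
  by (auto simp: linear_conv_bounded_linear[symmetric] linear_iff cvec_def vec_eq_iff
      scaleR_conv_of_real[where 'a=complex])

lemma bounded_linear_qvec: "bounded_linear qvec"
  by (auto simp: linear_conv_bounded_linear[symmetric] linear_iff qvec_def)

lemmas cvec_scaleR = linear_cmul[OF bounded_linear.linear[OF bounded_linear_cvec]]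
  and cvec_0 = linear_0[OF bounded_linear.linear[OF bounded_linear_cvec]]
  and qvec_scaleR = linear_cmul[OF bounded_linear.linear[OF bounded_linear_qvec]]
  and qvec_0 = linear_0[OF bounded_linear.linear[OF bounded_linear_qvec]]
  and qvec_diff = linear_diff[OF bounded_linear.linear[OF bounded_linear_qvec]]
  and qvec_sum = linear_sum[OF bounded_linear.linear[OF bounded_linear_qvec]]

lemma nu_da_eq_cross3: "nu_da r v w = cross3 v w"
  by (simp add: nu_da_def wedge_def coord_form_def cross3_def mult.commute)

lemma qmult_qvec_cvec: "qvec (cvec a) \<otimes>\<^sub>q qvec (cvec b) = (of_real (- (a \<bullet> b)), cvec (cross3 a b))"
  by (simp add: qmult_qvec cdot_3 ccross_def cross3_def cvec_def vec_eq_iff forall_3 inner_vec_def sum_3)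

text \<open>The left factors are \<open>a \<times> (a \<times> v)\<close> and
  \<open>a \<times> (a \<times> w)\<close>. With \<open>n = cross3 v w\<close>, symmetry cancels the
  terms in \<open>a \<bullet> a\<close> of the scalar part, leaving
  \<open>(M a) \<bullet> (a \<times> n)\<close>. The vector part rests on
  \<open>x \<times> M y + M x \<times> y = - M (x \<times> y)\<close>, valid for symmetric traceless
  \<open>M\<close>, applied to \<open>v, w\<close> and to \<open>a, a \<times> n\<close>. The proof
  eliminates the dependent entries and compares components.\<close>

lemma qmult_sym_traceless:
  fixes M :: "complex^3^3" and a v w :: "real^3"
  assumes sym: "transpose M = M" and tr: "trace M = 0"
  shows "qvec (cvec ((a \<bullet> v) *\<^sub>R a - (a \<bullet> a) *\<^sub>R v)) \<otimes>\<^sub>q qvec (M *v cvec w)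
       - qvec (cvec ((a \<bullet> w) *\<^sub>R a - (a \<bullet> a) *\<^sub>R w)) \<otimes>\<^sub>q qvec (M *v cvec v)
       = qvec (cvec a) \<otimes>\<^sub>q qvec (cvec (cross3 v w)) \<otimes>\<^sub>q qvec (M *v cvec (- a))"
proof -
  have s: "M$2$1 = M$1$2" "M$3$1 = M$1$3" "M$3$2 = M$2$3"
    using arg_cong[OF sym, of "\<lambda>A. A$2$1"] arg_cong[OF sym, of "\<lambda>A. A$3$1"]
      arg_cong[OF sym, of "\<lambda>A. A$3$2"] by (simp_all add: transpose_def)
  have "M$1$1 + M$2$2 + M$3$3 = 0"
    using tr by (simp add: trace_def sum_3)
  then have t: "M$3$3 = - M$1$1 - M$2$2"
    by algebra
  show ?thesis
    by (simp only: qmult_def qvec_def prod_eq_iff cdot_3 ccross_def vec_eq_iff forall_3 cvec_def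
        matrix_vector_mult_def vec_lambda_beta sum_3 s t cross3_def inner_vec_def vector_3
       fst_conv snd_conv fst_diff snd_diff vector_minus_component vector_add_component vector_uminus_component
       vector_scaleR_component vector_smult_component of_real_add of_real_mult of_real_diff of_real_minus inner_real_def
       mult_zero_left mult_zero_right add_0_left add_0_right diff_0 diff_0_right real_scaleR_def) (intro conjI; algebra)
qed

section \<open>Solid harmonics as coefficients of powers of an isotropic polynomial\<close>

lemma higher_deriv_poly: "(deriv ^^ n) (poly p) = poly ((pderiv ^^ n) p)"
  for p :: "real poly"
  by (induction n) (auto intro!: DERIV_imp_deriv poly_DERIV)

lemma higher_pderiv_pcompose_translate:
  fixes p :: "real poly"
  shows "(pderiv ^^ n) (pcompose p [:x, 1:]) = pcompose ((pderiv ^^ n) p) [:x, 1:]"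
  by (induction n) (simp_all add: pderiv_pcompose pderiv_pCons)

lemma pcompose_power: "pcompose (p ^ l) q = pcompose p q ^ l"
  for p :: "'a::comm_semiring_1 poly"
  by (induction l) (simp_all add: pcompose_mult pcompose_1)

text \<open>Taylor expansion at \<open>x\<close>: the kernel shifted by \<open>x\<close> is
  \<open>((x\<^sup>2 - 1) + 2 x t + t\<^sup>2) ^ l\<close>.\<close>

lemma higher_deriv_legendre_kernel:
  "(deriv ^^ n) (\<lambda>t. (t\<^sup>2 - 1) ^ l) x = fact n * coeff ([:x\<^sup>2 - 1, 2 * x, 1:] ^ l) n" for x :: real
proof -
  let ?p = "[:-1, 0, 1:] ^ l :: real poly"
  have "(\<lambda>t. (t\<^sup>2 - 1) ^ l) = poly ?p"
    by (auto simp: fun_eq_iff power2_eq_square)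
  then have "(deriv ^^ n) (\<lambda>t. (t\<^sup>2 - 1) ^ l) x = poly ((pderiv ^^ n) ?p) x"
    by (simp add: higher_deriv_poly)
  also have "\<dots> = coeff ((pderiv ^^ n) (pcompose ?p [:x, 1:])) 0"
    by (simp add: higher_pderiv_pcompose_translate poly_pcompose flip: poly_0_coeff_0)
  also have "\<dots> = fact n * coeff (pcompose ?p [:x, 1:]) n"
    by (simp add: coeff_higher_pderiv pochhammer_fact)
  also have "pcompose ?p [:x, 1:] = [:x\<^sup>2 - 1, 2 * x, 1:] ^ l"
    by (simp add: pcompose_power pcompose_pCons power2_eq_square)
  finally show ?thesis .
qed

lemma coeff_quadratic_power_of_real:
  "coeff ([:of_real a, of_real b, of_real c:] ^ l) n = (of_real (coeff ([:a, b, c:] ^ l) n) :: 'a::{real_algebra_1,comm_ring_1})"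
proof (induction l arbitrary: n)
  case (Suc l)
  have "coeff [:of_real a, of_real b, of_real c:] i = (of_real (coeff [:a, b, c:] i) :: 'a)" for i
    by (simp add: coeff_pCons split: nat.split)
  then show ?case
    by (simp only: power_Suc coeff_mult Suc.IH of_real_sum of_real_mult)
qed (simp add: one_pCons coeff_pCons split: nat.split)

lemma coeff_quadratic_power_scale:
  fixes h :: "'a::comm_ring_1"
  shows "coeff ([:a, b * h, c * h\<^sup>2:] ^ l) n = h ^ n * coeff ([:a, b, c:] ^ l) n"
proof -
  have "[:a, b * h, c * h\<^sup>2:] ^ l = pcompose ([:a, b, c:] ^ l) [:0, h:]"
    by (simp add: pcompose_power pcompose_pCons power2_eq_square mult_ac)
  then show ?thesis
    by (simp add: coeff_pcompose_linear)
qed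

text \<open>The value at \<open>t\<close> is the bilinear product of \<open>p\<close> with the null
  vector \<open>(t, (t\<^sup>2 - 1) / 2, \<i> (t\<^sup>2 + 1) / 2)\<close>, so its powers are
  harmonic in \<open>p\<close>. The first coordinate is the polar one because \<open>solid_S\<close>
  permutes the axes.\<close>

definition null_poly :: "real^3 \<Rightarrow> complex poly" where
  "null_poly p = [:- (Complex (p$2) (- (p$3)) / 2), of_real (p$1), Complex (p$2) (p$3) / 2:]"

text \<open>Since \<open>\<sigma>\<^sup>2 = 1 - x\<^sup>2\<close>, multiplying the quadratic by
  \<open>2 * \<sigma> * e\<close> gives the Taylor quadratic of the Legendre kernel with its
  variable rescaled by \<open>\<sigma> * e\<close>. At index \<open>l + m\<close> this leaves the
  power \<open>m\<close> of that factor.\<close>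

lemma coeff_legendre_poly_power:
  fixes x :: real and e :: complex and m :: int
  assumes "\<bar>x\<bar> \<le> 1" "norm e = 1" "\<bar>m\<bar> \<le> int l"
  defines "\<sigma> \<equiv> sqrt (1 - x\<^sup>2)"
  shows "2 ^ l * coeff ([:- (\<sigma> * cnj e / 2), of_real x, \<sigma> * e / 2:] ^ l) (nat (int l + m)) =
    of_real (\<sigma> powi m * coeff ([:x\<^sup>2 - 1, 2 * x, 1:] ^ l) (nat (int l + m))) * e powi m"
    (is "2 ^ l * coeff (?B ^ l) ?n = _")
proof (cases "\<sigma> = 0")
  case False
  have x2: "x\<^sup>2 \<le> 1"
    using assms(1) by (simp add: abs_square_le_1)
  then have s2: "\<sigma>\<^sup>2 = 1 - x\<^sup>2"
    by (simp add: \<sigma>_def)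
  have ee: "e * cnj e = 1"
    using assms(2) by (simp add: complex_norm_square[symmetric])
  have e0: "e \<noteq> 0"
    using assms(2) by auto
  let ?h = "\<sigma> * e"
  have h0: "?h \<noteq> 0"
    using False e0 by simp
  have "smult (2 * ?h) ?B = [:of_real (x\<^sup>2 - 1), of_real (2 * x) * ?h, of_real 1 * ?h\<^sup>2:]"
  proof -
    have "?h * (\<sigma> * cnj e) = of_real (\<sigma>\<^sup>2)"
      using ee by (simp add: power2_eq_square mult_ac)
    then show ?thesis
      unfolding s2 by (simp add: power2_eq_square algebra_simps)
  qed
  then have "coeff (smult (2 * ?h) ?B ^ l) ?n = ?h ^ ?n * of_real (coeff ([:x\<^sup>2 - 1, 2 * x, 1:] ^ l) ?n)"
    by (simp only: coeff_quadratic_power_scale coeff_quadratic_power_of_real)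
  then have "?h ^ l * (2 ^ l * coeff (?B ^ l) ?n) = ?h ^ ?n * of_real (coeff ([:x\<^sup>2 - 1, 2 * x, 1:] ^ l) ?n)"
    unfolding smult_power coeff_smult power_mult_distrib[of 2] by (simp only: mult_ac)
  also have "?h ^ ?n = ?h powi (int l + m)"
    using assms(3) by (simp add: power_int_def)
  also have "\<dots> = ?h ^ l * ?h powi m"
    using h0 by (simp add: power_int_add)
  finally have "2 ^ l * coeff (?B ^ l) ?n = ?h powi m * of_real (coeff ([:x\<^sup>2 - 1, 2 * x, 1:] ^ l) ?n)"
    using h0 by simp
  then show ?thesis
    by (simp add: power_int_mult_distrib mult_ac of_real_power_int)
next
  \<comment> \<open>On the polar axis the rescaling factor is 0. The quadratic becomes the monomial
    \<open>x t\<close>; for \<open>m \<noteq> 0\<close> both sides vanish, also for negative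
    \<open>m\<close> because \<open>0 powi m = 0\<close>.\<close>
  case True
  have "x\<^sup>2 = 1"
    using True by (simp add: \<sigma>_def)
  have B: "?B ^ l = monom (of_real (x ^ l)) l"
  proof -
    have "?B = monom (of_real x) 1"
      using True by (simp add: monom_Suc monom_0)
    then show ?thesis
      by (simp add: monom_power)
  qed
  show ?thesis
  proof (cases "m = 0")
    case False
    then show ?thesis
      using True assms(3) B by (auto simp: power_int_0_left_if nat_eq_iff)
  next
    case m: True
    have "[:x\<^sup>2 - 1, 2 * x, 1:] ^ l = monom 1 l * [:2 * x, 1:] ^ l"
      using \<open>x\<^sup>2 = 1\<close> by (simp add: monom_altdef flip: power_mult_distrib)
    then have "coeff ([:x\<^sup>2 - 1, 2 * x, 1:] ^ l) l = (2 * x) ^ l"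
      by (simp add: coeff_monom_mult coeff_0_power)
    then show ?thesis
      using m B by (simp add: power_mult_distrib)
  qed
qed

text \<open>Spherical coordinates about the first axis. Where the phase \<open>e\<close> is only
  conventional, it is multiplied by 0.\<close>

lemma null_poly_polar:
  fixes p :: "real^3" and x :: real and e :: complex
  defines "x \<equiv> p$1 / norm p" and "e \<equiv> cis (Arg (Complex (p$2) (p$3)))"
  shows "null_poly p = smult (norm p)
    [:- (sqrt (1 - x\<^sup>2) * cnj e / 2), of_real x, sqrt (1 - x\<^sup>2) * e / 2:]"
proof (cases "p = 0")
  case True
  then show ?thesis by (simp add: null_poly_def Complex_eq)
next
  case False
  have n2: "(norm p)\<^sup>2 = (p$1)\<^sup>2 + (p$2)\<^sup>2 + (p$3)\<^sup>2"
    by (simp add: norm_vec_def L2_set_def sum_3 sum_nonneg)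
  have "(norm p)\<^sup>2 * x\<^sup>2 = (p$1)\<^sup>2"
    using False by (simp add: x_def power_divide)
  then have px: "(norm p)\<^sup>2 * (1 - x\<^sup>2) = (p$2)\<^sup>2 + (p$3)\<^sup>2"
    using n2 by (simp add: right_diff_distrib)
  have "norm p * sqrt (1 - x\<^sup>2) = sqrt ((norm p)\<^sup>2 * (1 - x\<^sup>2))"
    by (simp add: real_sqrt_mult)
  also note px
  finally have r: "norm p * sqrt (1 - x\<^sup>2) = cmod (Complex (p$2) (p$3))"
    by (simp add: cmod_def)
  have xi: "of_real (norm p * sqrt (1 - x\<^sup>2)) * e = Complex (p$2) (p$3)"
    unfolding r e_def using rcis_cmod_Arg[of "Complex (p$2) (p$3)"] by (simp add: rcis_def)
  then have "of_real (norm p * sqrt (1 - x\<^sup>2)) * cnj e = Complex (p$2) (- (p$3))"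
    by (metis complex_cnj complex_cnj_complex_of_real complex_cnj_mult)
  then show ?thesis
    using xi False by (simp add: null_poly_def x_def mult_ac)
qed

text \<open>What remains of the normalisation after Rodrigues' formula contributes
  \<open>1 / fact l\<close> and the Taylor coefficient a factor \<open>(l + m)!\<close> outside the
  root; \<open>2 ^ l\<close> cancels against the halves in \<open>null_poly\<close>.\<close>

definition harmonic_norm :: "nat \<Rightarrow> int \<Rightarrow> real" where
  "harmonic_norm l m = sqrt (fact (nat (int l - m)) * fact (nat (int l + m))) / fact l"

lemma solid_S_eq_coeff:
  assumes "\<bar>m\<bar> \<le> int l"
  shows "solid_S l m p = harmonic_norm l m * coeff (null_poly p ^ l) (nat (int l + m))"
proof -
  let ?x = "p$1 / norm p" and ?e = "cis (Arg (Complex (p$2) (p$3)))" and ?n = "nat (int l + m)"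
  let ?\<sigma> = "sqrt (1 - ?x\<^sup>2)" and ?a = "coeff ([:?x\<^sup>2 - 1, 2 * ?x, 1:] ^ l) ?n"
  let ?N = "fact (nat (int l - m)) :: real" and ?M = "fact ?n :: real"
  have nrm: "norm (vector [p$2, p$3, p$1] :: real^3) = norm p"
    by (simp add: norm_vec_def L2_set_def sum_3 add_ac)
  have x1: "\<bar>?x\<bar> \<le> 1"
    using component_le_norm_cart[of p 1] by (simp add: divide_le_eq_1)
  have exp: "exp (\<i> * of_int m * complex_of_real (Arg (Complex (p$2) (p$3)))) = ?e powi m"
    unfolding cis_power_int by (simp add: cis_conv_exp mult_ac)
  have leg: "assoc_legendre l m ?x = 1 / (2 ^ l * fact l) * ?\<sigma> powi m * (?M * ?a)"
    by (simp only: assoc_legendre_def higher_deriv_legendre_kernel)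
  have "sqrt (?N / ?M) * ?M = sqrt (?N / ?M * ?M\<^sup>2)"
    unfolding real_sqrt_mult by simp
  also have "\<dots> = sqrt (?N * ?M)"
    by (simp add: power2_eq_square)
  finally have sq: "sqrt (?N / ?M) * ?M = sqrt (?N * ?M)" .
  have c: "2 ^ l * coeff (null_poly p ^ l) ?n =
      of_real (norm p ^ l) * (of_real (?\<sigma> powi m * ?a) * ?e powi m)"
    unfolding null_poly_polar smult_power coeff_smult
    using coeff_legendre_poly_power[OF x1 _ assms, of ?e] by (simp add: mult_ac)
  have "solid_S l m p = of_real (sqrt (?N / ?M) * norm p ^ l *
      (1 / (2 ^ l * fact l) * ?\<sigma> powi m * (?M * ?a))) * ?e powi m"
    by (simp only: solid_S_def solid_R_def nrm vector_3 leg exp)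
  also have "sqrt (?N / ?M) * norm p ^ l * (1 / (2 ^ l * fact l) * ?\<sigma> powi m * (?M * ?a))
      = harmonic_norm l m / 2 ^ l * (norm p ^ l * (?\<sigma> powi m * ?a))"
    unfolding harmonic_norm_def sq[symmetric] by (simp add: mult_ac)
  also have "of_real \<dots> * ?e powi m = harmonic_norm l m * (1 / 2 ^ l) * (of_real (norm p ^ l) * (of_real (?\<sigma> powi m * ?a) * ?e powi m))"
    by simp
  also have "\<dots> = harmonic_norm l m * coeff (null_poly p ^ l) ?n"
    unfolding c[symmetric] by simp
  finally show ?thesis .
qed

section \<open>Gradients and the addition theorem\<close>

lemma null_poly_add: "null_poly (p + q) = null_poly p + null_poly q"
  by (simp add: null_poly_def complex_eq_iff field_simps)

lemma null_poly_scaleR: "null_poly (c *\<^sub>R p) = smult (of_real c) (null_poly p)"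
  by (simp add: null_poly_def complex_eq_iff)

lemma null_poly_minus: "null_poly (- p) = - null_poly p"
  using null_poly_scaleR[of "-1" p] by simp

lemma null_poly_diff: "null_poly (p - q) = null_poly p - null_poly q"
  using null_poly_add[of p "- q"] by (simp add: null_poly_minus)

lemma null_poly_sum_axis: "null_poly v = (\<Sum>i\<in>UNIV. smult (of_real (v$i)) (null_poly (axis i 1)))"
  by (simp add: sum_3 null_poly_def axis_def complex_eq_iff)

lemma null_poly_isotropic: "(\<Sum>i\<in>UNIV. null_poly (axis i 1) ^ 2) = 0"
  by (simp add: sum_3 null_poly_def axis_def power2_eq_square Complex_eq)

lemma degree_null_poly: "degree (null_poly p) \<le> 2"
  by (simp add: null_poly_def)

lemma degree_null_poly_power: "degree (null_poly p ^ l) \<le> 2 * l"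
  using degree_power_le[of "null_poly p" l] degree_null_poly[of p]
  by (meson le_trans mult_le_mono1)

lemma bounded_linear_coeff_null_poly: "bounded_linear (\<lambda>v. coeff (g * null_poly v) n)"
  by (auto simp: linear_conv_bounded_linear[symmetric] linear_iff null_poly_add null_poly_scaleR
      distrib_left scaleR_conv_of_real[where 'a=complex])

lemma has_derivative_coeff_mult:
  fixes f g :: "'a::real_normed_vector \<Rightarrow> 'b::real_normed_field poly"
  assumes "\<And>n. ((\<lambda>s. coeff (f s) n) has_derivative (\<lambda>v. coeff (f' v) n)) (at r)"
    and "\<And>n. ((\<lambda>s. coeff (g s) n) has_derivative (\<lambda>v. coeff (g' v) n)) (at r)"
  shows "((\<lambda>s. coeff (f s * g s) n) has_derivative (\<lambda>v. coeff (f r * g' v + f' v * g r) n)) (at r)"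
proof -
  have "((\<lambda>s. \<Sum>i\<le>n. coeff (f s) i * coeff (g s) (n - i)) has_derivative
      (\<lambda>v. \<Sum>i\<le>n. coeff (f r) i * coeff (g' v) (n - i) + coeff (f' v) i * coeff (g r) (n - i))) (at r)"
    by (intro has_derivative_sum has_derivative_mult assms)
  then show ?thesis
    by (simp add: coeff_mult sum.distrib)
qed

lemma has_derivative_coeff_null_poly_power:
  "((\<lambda>s. coeff (null_poly s ^ l) n) has_derivative
    (\<lambda>v. coeff (of_nat l * null_poly r ^ (l - 1) * null_poly v) n)) (at r)"
proof (induction l arbitrary: n)
  case (Suc l)
  have Q: "((\<lambda>s. coeff (null_poly s) n) has_derivative (\<lambda>v. coeff (null_poly v) n)) (at r)" for n
    using bounded_linear_imp_has_derivative[OF bounded_linear_coeff_null_poly[of 1 n]] by simp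
  have eq: "null_poly r * (of_nat l * null_poly r ^ (l - 1) * null_poly v) + null_poly v * null_poly r ^ l
     = of_nat (Suc l) * null_poly r ^ (Suc l - 1) * null_poly v" for v
    by (cases l) (simp_all add: algebra_simps)
  show ?case
    using has_derivative_coeff_mult[OF Q Suc.IH, of n] by (simp only: eq power_Suc)
qed simp

lemma has_derivative_coeff_mult_null_poly_power:
  "((\<lambda>s. coeff (g * null_poly s ^ l) n) has_derivative
    (\<lambda>v. coeff (of_nat l * g * null_poly r ^ (l - 1) * null_poly v) n)) (at r)"
proof -
  have "((\<lambda>s. coeff g m) has_derivative (\<lambda>v. coeff 0 m)) (at r)" for m
    by simp
  from has_derivative_coeff_mult[OF this has_derivative_coeff_null_poly_power]
  show ?thesis by (simp add: mult_ac)
qed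

lemma grad_solid_S:
  assumes "\<bar>m\<bar> \<le> int l"
  shows "grad (solid_S l m) r $ i = harmonic_norm l m *
    coeff (of_nat l * null_poly r ^ (l - 1) * null_poly (axis i 1)) (nat (int l + m))"
proof -
  have "solid_S l m = (\<lambda>s. harmonic_norm l m * coeff (null_poly s ^ l) (nat (int l + m)))"
    using solid_S_eq_coeff[OF assms] by auto
  then have "(solid_S l m has_derivative (\<lambda>v. harmonic_norm l m *
      coeff (of_nat l * null_poly r ^ (l - 1) * null_poly v) (nat (int l + m)))) (at r)"
    by (simp only: has_derivative_mult_right has_derivative_coeff_null_poly_power)
  from frechet_derivative_at[OF this] show ?thesis
    by (metis (no_types, lifting) grad_def vec_lambda_beta)
qed

section \<open>The addition theorem: sums over the order as Cauchy products\<close>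

lemma sum_coeff_mult_upto:
  fixes p q :: "'a::comm_semiring_1 poly"
  assumes "degree p \<le> d"
  shows "(\<Sum>i\<le>d. coeff p i * (if i \<le> n then coeff q (n - i) else 0)) = coeff (p * q) n"
proof -
  \<comment> \<open>Natural subtraction would read \<open>coeff q 0\<close> whenever
    \<open>i > n\<close>; the guard removes those terms.\<close>
  have "(\<Sum>i\<le>d. coeff p i * (if i \<le> n then coeff q (n - i) else 0)) =
      (\<Sum>i\<in>{..d} \<inter> {..n}. coeff p i * coeff q (n - i))"
    by (auto intro!: sum.mono_neutral_cong_right split: if_splits)
  also have "\<dots> = (\<Sum>i\<le>n. coeff p i * coeff q (n - i))"
  proof (rule sum.mono_neutral_left)
    have "coeff p i = 0" if "\<not> i \<le> d" for i
      using that assms by (intro coeff_eq_0) auto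
    then show "\<forall>i\<in>{..n} - {..d} \<inter> {..n}. coeff p i * coeff q (n - i) = 0"
      by (metis DiffE IntI atMost_iff mult_zero_left)
  qed auto
  finally show ?thesis by (simp add: coeff_mult)
qed

lemma harmonic_norm_T_coeff_nat:
  fixes a b i h :: nat
  assumes "i \<le> a" "h \<le> b"
  shows "sqrt (fact (b - h) * fact (a - i)) * (sqrt (a choose i) * sqrt (b choose h)) *
    sqrt (fact h * fact i) = sqrt (fact b * fact a)"
proof -
  have "fact (b - h) * fact (a - i) * (real (a choose i) * real (b choose h)) * (fact h * fact i) = fact b * fact a"
    using assms by (simp add: binomial_fact field_simps)
  then show ?thesis
    by (metis real_sqrt_mult)
qed

text \<open>Under the root the binomials in \<open>T_coeff\<close> absorb the factorials of the two
  smaller harmonics, leaving those of \<open>l + m\<close> and \<open>l - m\<close>; the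
  denominators \<open>fact (l - j) * fact j\<close> against \<open>fact l\<close> give the
  binomial.\<close>

lemma harmonic_norm_T_coeff:
  assumes "j \<le> l" "\<bar>k\<bar> \<le> int j" "\<bar>m\<bar> \<le> int l" "\<bar>m - k\<bar> \<le> int (l - j)"
  shows "harmonic_norm (l - j) (m - k) * T_coeff j k l m * harmonic_norm j k
    = harmonic_norm l m * (l choose j)"
proof -
  define a b i h where abih: "a = nat (int l + m)" "b = nat (int l - m)" "i = nat (int j + k)" "h = nat (int j - k)"
  have le: "i \<le> a" "h \<le> b"
    using assms by (auto simp: abih)
  have eqs: "nat (int (l - j) - (m - k)) = b - h" "nat (int (l - j) + (m - k)) = a - i"
    using assms by (auto simp: abih)
  have T: "T_coeff j k l m = sqrt (a choose i) * sqrt (b choose h)"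
    using assms by (auto simp: T_coeff_def binom_int_def abih)
  have "harmonic_norm (l - j) (m - k) * T_coeff j k l m * harmonic_norm j k =
     (sqrt (fact (b - h) * fact (a - i)) * (sqrt (a choose i) * sqrt (b choose h)) * sqrt (fact h * fact i))
        / (fact (l - j) * fact j)"
    by (simp add: harmonic_norm_def T eqs flip: abih)
  also have "\<dots> = harmonic_norm l m * (l choose j)"
    using assms(1) unfolding harmonic_norm_T_coeff_nat[OF le]
    by (simp add: harmonic_norm_def binomial_fact flip: abih)
  finally show ?thesis .
qed

text \<open>Outside \<open>\<bar>m - k\<bar> \<le> l - j\<close> the value of \<open>solid_S\<close> is meaningless,
  but there \<open>T_coeff\<close> vanishes.\<close>

lemma solid_S_T_coeff:
  assumes "j \<le> l" "\<bar>k\<bar> \<le> int j" "\<bar>m\<bar> \<le> int l"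
  shows "solid_S (l - j) (m - k) r' * T_coeff j k l m * harmonic_norm j k =
    harmonic_norm l m * (l choose j) * (if nat (int j + k) \<le> nat (int l + m)
      then coeff (null_poly r' ^ (l - j)) (nat (int l + m) - nat (int j + k)) else 0)"
proof (cases "\<bar>m - k\<bar> \<le> int (l - j)")
  case True
  have "nat (int (l - j) + (m - k)) = nat (int l + m) - nat (int j + k)" "nat (int j + k) \<le> nat (int l + m)"
    using True assms by auto
  moreover have "solid_S (l - j) (m - k) r' * T_coeff j k l m * harmonic_norm j k =
    of_real (harmonic_norm (l - j) (m - k) * T_coeff j k l m * harmonic_norm j k) *
    coeff (null_poly r' ^ (l - j)) (nat (int (l - j) + (m - k)))"
    by (simp add: solid_S_eq_coeff[OF True])
  ultimately show ?thesis
    unfolding harmonic_norm_T_coeff[OF assms True] by simp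
next
  case False
  then have "T_coeff j k l m = 0"
    using assms by (auto simp: T_coeff_def binom_int_def)
  \<comment> \<open>The right side vanishes too: if \<open>m - k > l - j\<close>, the index exceeds
    the degree bound \<open>2 * (l - j)\<close>; if \<open>m - k < - (l - j)\<close>, then
    \<open>j + k > l + m\<close> and the guard gives 0.\<close>
  moreover have "coeff (null_poly r' ^ (l - j)) (nat (int l + m) - nat (int j + k)) = 0"
    if "nat (int j + k) \<le> nat (int l + m)"
  proof -
    have "int l - int j < m - k"
      using that False assms by linarith
    then have "2 * (l - j) < nat (int l + m) - nat (int j + k)"
      using assms by linarith
    then show ?thesis
      using degree_null_poly_power[of r' "l - j"] by (intro coeff_eq_0) linarith
  qed
  ultimately show ?thesis by auto
qed

text \<open>With \<open>a = j + k\<close>, the gradient contributes coefficient \<open>a\<close> of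
  a polynomial depending on \<open>r\<close>, and the harmonic at \<open>r'\<close> coefficient
  \<open>l + m - a\<close> of \<open>null_poly r' ^ (l - j)\<close>. Summing over \<open>k\<close>
  is a Cauchy product: the addition theorem in gradient form.\<close>

lemma sum_solid_S_grad:
  assumes "1 \<le> j" "j \<le> l" "\<bar>m\<bar> \<le> int l"
  shows "(\<Sum>k = - int j..int j. (solid_S (l - j) (m - k) r' * T_coeff j k l m) * grad (solid_S j k) r $ i)
    = harmonic_norm l m * (l choose j) * coeff (of_nat j * null_poly r ^ (j - 1) * null_poly (axis i 1)
        * null_poly r' ^ (l - j)) (nat (int l + m))"
proof -
  let ?p = "of_nat j * null_poly r ^ (j - 1) * null_poly (axis i 1)"
  let ?n = "nat (int l + m)"
  let ?f = "\<lambda>a. harmonic_norm l m * (l choose j) * (coeff ?p a * (if a \<le> ?n then coeff (null_poly r' ^ (l - j)) (?n - a) else 0))"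
  have deg: "degree ?p \<le> 2 * j"
  proof -
    have "degree ?p \<le> degree (of_nat j * null_poly r ^ (j - 1)) + degree (null_poly (axis i 1))"
      by (rule degree_mult_le)
    also have "degree (of_nat j * null_poly r ^ (j - 1)) \<le> degree (of_nat j :: complex poly) + degree (null_poly r ^ (j - 1))"
      by (rule degree_mult_le)
    finally show ?thesis
      using degree_null_poly_power[of r "j - 1"] degree_null_poly[of "axis i 1"] assms(1) by simp
  qed
  have "(solid_S (l - j) (m - k) r' * T_coeff j k l m) * grad (solid_S j k) r $ i = ?f (nat (int j + k))"
    if "k \<in> {- int j..int j}" for k
  proof -
    have k: "\<bar>k\<bar> \<le> int j" using that by auto
    have "(solid_S (l - j) (m - k) r' * T_coeff j k l m) * grad (solid_S j k) r $ i =
       (solid_S (l - j) (m - k) r' * T_coeff j k l m * harmonic_norm j k) * coeff ?p (nat (int j + k))"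
      unfolding grad_solid_S[OF k] by (simp only: mult_ac)
    then show ?thesis
      unfolding solid_S_T_coeff[OF assms(2) k assms(3)] by (simp only: mult_ac)
  qed
  then have "(\<Sum>k = - int j..int j. (solid_S (l - j) (m - k) r' * T_coeff j k l m) * grad (solid_S j k) r $ i)
      = (\<Sum>k = - int j..int j. ?f (nat (int j + k)))"
    by (rule sum.cong[OF refl])
  also have "\<dots> = (\<Sum>a\<le>2 * j. ?f a)"
    by (rule sum.reindex_bij_witness[where i = "\<lambda>a. int a - int j" and j = "\<lambda>k. nat (int j + k)"]) auto
  also have "\<dots> = harmonic_norm l m * (l choose j) * coeff (?p * null_poly r' ^ (l - j)) ?n"
    unfolding sum_distrib_left[symmetric] sum_coeff_mult_upto[OF deg] ..
  finally show ?thesis .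
qed

section \<open>Exterior derivatives\<close>

text \<open>Differentiability and value are carried together so that the rules below compose.
  \<open>D v\<close> differentiates the form with its tangent argument frozen at \<open>v\<close>;
  hence \<open>D w v\<close> is the derivative of the value at \<open>w\<close> in direction
  \<open>v\<close>.\<close>

definition has_ext_deriv1 :: "'v::real_normed_vector form1 \<Rightarrow> (real^3 \<Rightarrow> real^3 \<Rightarrow> 'v) \<Rightarrow> real^3 \<Rightarrow> bool" where
  "has_ext_deriv1 \<beta> E r \<longleftrightarrow>
    (\<exists>D. (\<forall>v. ((\<lambda>s. \<beta> s v) has_derivative D v) (at r)) \<and> (\<forall>v w. D w v - D v w = E v w))"

lemma has_ext_deriv1I:
  assumes "\<And>v. ((\<lambda>s. \<beta> s v) has_derivative D v) (at r)" "\<And>v w. D w v - D v w = E v w"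
  shows "has_ext_deriv1 \<beta> E r"
  using assms unfolding has_ext_deriv1_def by blast

lemma has_ext_deriv1D:
  assumes "has_ext_deriv1 \<beta> E r"
  shows "form1_differentiable_at \<beta> r" "ext_deriv1 \<beta> r = E"
proof -
  obtain D where D: "\<And>v. ((\<lambda>s. \<beta> s v) has_derivative D v) (at r)" and E: "\<And>v w. D w v - D v w = E v w"
    using assms unfolding has_ext_deriv1_def by blast
  show "form1_differentiable_at \<beta> r"
    using D by (auto simp: form1_differentiable_at_def differentiable_def)
  show "ext_deriv1 \<beta> r = E"
    by (intro ext) (simp add: ext_deriv1_def E flip: frechet_derivative_at[OF D])
qed

lemma has_ext_deriv1_add:
  assumes "has_ext_deriv1 \<beta> E r" "has_ext_deriv1 \<gamma> G r"
  shows "has_ext_deriv1 (\<lambda>s v. \<beta> s v + \<gamma> s v) (\<lambda>v w. E v w + G v w) r"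
proof -
  obtain D where D: "\<And>v. ((\<lambda>s. \<beta> s v) has_derivative D v) (at r)" and E: "\<And>v w. D w v - D v w = E v w"
    using assms(1) unfolding has_ext_deriv1_def by blast
  obtain D' where D': "\<And>v. ((\<lambda>s. \<gamma> s v) has_derivative D' v) (at r)" and G: "\<And>v w. D' w v - D' v w = G v w"
    using assms(2) unfolding has_ext_deriv1_def by blast
  show ?thesis
    unfolding has_ext_deriv1_def
    by (intro exI[of _ "\<lambda>v w. D v w + D' v w"] conjI allI has_derivative_add D D') (simp add: E[symmetric] G[symmetric])
qed

lemma has_ext_deriv1_linear:
  assumes "bounded_linear f" "has_ext_deriv1 \<beta> E r"
  shows "has_ext_deriv1 (\<lambda>s v. f (\<beta> s v)) (\<lambda>v w. f (E v w)) r"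
proof -
  interpret bounded_linear f by fact
  obtain D where D: "\<And>v. ((\<lambda>s. \<beta> s v) has_derivative D v) (at r)" and E: "\<And>v w. D w v - D v w = E v w"
    using assms(2) unfolding has_ext_deriv1_def by blast
  show ?thesis
    unfolding has_ext_deriv1_def
    by (intro exI[of _ "\<lambda>v w. f (D v w)"] conjI allI has_derivative D) (simp add: E[symmetric] diff)
qed

lemma has_ext_deriv1_Pair:
  assumes "has_ext_deriv1 \<beta> E r" "has_ext_deriv1 \<gamma> G r"
  shows "has_ext_deriv1 (\<lambda>s v. (\<beta> s v, \<gamma> s v)) (\<lambda>v w. (E v w, G v w)) r"
proof -
  obtain D where D: "\<And>v. ((\<lambda>s. \<beta> s v) has_derivative D v) (at r)" and E: "\<And>v w. D w v - D v w = E v w"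
    using assms(1) unfolding has_ext_deriv1_def by blast
  obtain D' where D': "\<And>v. ((\<lambda>s. \<gamma> s v) has_derivative D' v) (at r)" and G: "\<And>v w. D' w v - D' v w = G v w"
    using assms(2) unfolding has_ext_deriv1_def by blast
  show ?thesis
    unfolding has_ext_deriv1_def
    by (intro exI[of _ "\<lambda>v w. (D v w, D' v w)"] conjI allI has_derivative_Pair D D') (simp add: E[symmetric] G[symmetric])
qed

text \<open>Leibniz rule \<open>d(\<beta> F) = d\<beta> F - \<beta> \<and> dF\<close>; the sign
  comes from moving \<open>d\<close> past a 1-form, and the order of factors is kept since
  \<open>b\<close> may fail to commute.\<close>

lemma has_ext_deriv1_bilinear:
  assumes "bounded_bilinear b" "has_ext_deriv1 \<beta> E r" "(F has_derivative F') (at r)"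
  shows "has_ext_deriv1 (\<lambda>s v. b (\<beta> s v) (F s))
    (\<lambda>v w. b (E v w) (F r) - (b (\<beta> r v) (F' w) - b (\<beta> r w) (F' v))) r"
proof -
  interpret bounded_bilinear b by fact
  obtain D where D: "\<And>v. ((\<lambda>s. \<beta> s v) has_derivative D v) (at r)" and E: "\<And>v w. D w v - D v w = E v w"
    using assms(2) unfolding has_ext_deriv1_def by blast
  show ?thesis
    unfolding has_ext_deriv1_def
    by (intro exI[of _ "\<lambda>v w. b (\<beta> r v) (F' w) + b (D v w) (F r)"] conjI allI FDERIV D assms(3))
      (simp add: E[symmetric] diff_left)
qed

lemma has_ext_deriv1_cong:
  assumes "has_ext_deriv1 \<beta> E r" "open U" "r \<in> U" "\<And>s v. s \<in> U \<Longrightarrow> \<beta> s v = \<gamma> s v"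
  shows "has_ext_deriv1 \<gamma> E r"
proof -
  obtain D where D: "\<And>v. ((\<lambda>s. \<beta> s v) has_derivative D v) (at r)" and E: "\<And>v w. D w v - D v w = E v w"
    using assms(1) unfolding has_ext_deriv1_def by blast
  show ?thesis
    by (rule has_ext_deriv1I[OF has_derivative_transform_within_open[OF D assms(2-4)] E])
qed

section \<open>Derivatives of the distance kernels\<close>

lemma has_derivative_norm_diff:
  fixes r' r :: "'a::real_inner"
  assumes "r \<noteq> r'"
  shows "((\<lambda>s. norm (r' - s)) has_derivative (\<lambda>v. - ((r' - r) \<bullet> v) / norm (r' - r))) (at r)"
proof -
  have "((\<lambda>s. r' - s) has_derivative (\<lambda>v. - v)) (at r)"
    by (auto intro!: derivative_eq_intros)
  from has_derivative_compose[OF this has_derivative_norm] show ?thesis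
    using assms by (auto elim!: has_derivative_eq_rhs simp: sgn_div_norm inner_commute divide_inverse)
qed

lemma has_derivative_inverse_dist:
  fixes r' r :: "'a::real_inner"
  assumes "r \<noteq> r'"
  shows "((\<lambda>s. inverse (norm (r' - s))) has_derivative
    (\<lambda>v. ((r' - r) \<bullet> v) * inverse (norm (r' - r)) ^ 3)) (at r)"
  using Deriv.has_derivative_inverse[OF _ has_derivative_norm_diff[OF assms]] assms
  by (auto elim!: has_derivative_eq_rhs simp: power3_eq_cube divide_inverse mult_ac)

text \<open>The differential of the unit vector from \<open>s\<close> towards \<open>r'\<close>, in
  closed form so that it can be differentiated again.\<close>

definition unit_deriv :: "real^3 \<Rightarrow> (real^3) form1" where
  "unit_deriv r' s v = (inverse (norm (r' - s)) ^ 3 * ((r' - s) \<bullet> v)) *\<^sub>R (r' - s) - inverse (norm (r' - s)) *\<^sub>R v"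

lemma ext_deriv0_unit:
  assumes "r \<noteq> r'"
  shows "ext_deriv0 (\<lambda>s. (r' - s) /\<^sub>R norm (r' - s)) r = unit_deriv r' r"
proof -
  define N where "N s = inverse (norm (r' - s))" for s
  have N: "(N has_derivative (\<lambda>v. ((r' - r) \<bullet> v) * N r ^ 3)) (at r)"
    unfolding N_def by (rule has_derivative_inverse_dist[OF assms])
  have "((\<lambda>s. N s *\<^sub>R (r' - s)) has_derivative unit_deriv r' r) (at r)"
    unfolding unit_deriv_def N_def[symmetric]
    by (auto intro!: derivative_eq_intros N ext simp: mult_ac)
  then have "((\<lambda>s. (r' - s) /\<^sub>R norm (r' - s)) has_derivative unit_deriv r' r) (at r)"
    by (simp add: N_def)
  from frechet_derivative_at[OF this] show ?thesis
    by (simp add: ext_deriv0_def fun_eq_iff)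
qed

text \<open>An instance of \<open>d \<circ> d = 0\<close>: the second derivative \<open>?D\<close>
  is symmetric in \<open>v\<close> and \<open>w\<close>.\<close>

lemma has_ext_deriv1_unit_deriv:
  assumes "r \<noteq> r'"
  shows "has_ext_deriv1 (unit_deriv r') (\<lambda>v w. 0) r"
proof -
  define N where "N s = inverse (norm (r' - s))" for s
  define h where "h = r' - r"
  have N: "(N has_derivative (\<lambda>v. (h \<bullet> v) * N r ^ 3)) (at r)"
    unfolding N_def h_def by (rule has_derivative_inverse_dist[OF assms])
  let ?D = "\<lambda>v w. (3 * N r ^ 5 * (h \<bullet> v) * (h \<bullet> w)) *\<^sub>R h
     - (N r ^ 3) *\<^sub>R ((v \<bullet> w) *\<^sub>R h + (h \<bullet> v) *\<^sub>R w + (h \<bullet> w) *\<^sub>R v)"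
  have "((\<lambda>s. unit_deriv r' s v) has_derivative ?D v) (at r)" for v
    unfolding unit_deriv_def N_def[symmetric]
    by (auto intro!: derivative_eq_intros N ext
        simp: h_def algebra_simps inner_commute power_numeral_reduce)
  then show ?thesis
    by (rule has_ext_deriv1I) (simp add: algebra_simps inner_commute)
qed

text \<open>The derivative is minus the wedge of \<open>d(1 / |r' - r|)\<close> with
  \<open>dr\<close>, which Lagrange's identity turns into a double cross product.\<close>

lemma has_ext_deriv1_omega_vec_form:
  assumes "r \<noteq> r'"
  shows "has_ext_deriv1 (omega_vec_form r')
    (\<lambda>v w. inverse (norm (r' - r)) ^ 3 *\<^sub>R cross3 (r' - r) (cross3 v w)) r"
proof -
  let ?D = "\<lambda>v w. - (((r' - r) \<bullet> w) * inverse (norm (r' - r)) ^ 3) *\<^sub>R v"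
  have dr: "dr_form s v = v" for s v
    by (simp add: dr_form_def coord_form_def)
  have "((\<lambda>s. omega_vec_form r' s v) has_derivative ?D v) (at r)" for v
    unfolding omega_vec_form_def dr
    using has_derivative_minus[OF has_derivative_scaleR_left[OF has_derivative_inverse_dist[OF assms], of v]] by simp
  then show ?thesis
    by (rule has_ext_deriv1I) (simp add: Lagrange algebra_simps)
qed

text \<open>\<open>omega0_form\<close> is a vector potential of the monopole field, with its Dirac string in direction \<open>u\<close>.\<close>

lemma has_ext_deriv1_omega0_form:
  assumes "r \<noteq> r'" "norm u = 1" "0 \<le> (r' - r) \<bullet> u"
  shows "has_ext_deriv1 (omega0_form u r')
    (\<lambda>v w. - (inverse (norm (r' - r)) ^ 3 * ((r' - r) \<bullet> cross3 v w))) r"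
proof -
  define h \<rho> c where "h = r' - r" and "\<rho> = norm h" and "c = u \<bullet> h"
  define g where "g = inverse (\<rho> * (\<rho> + c))"
  \<comment> \<open>\<open>X\<close> is the gradient of \<open>\<rho> * (\<rho> + c)\<close> in
    \<open>h\<close>; since \<open>h = r' - r\<close>, the derivative in the base point carries a
    minus sign.\<close>
  define X where "X = 2 *\<^sub>R h + (c / \<rho>) *\<^sub>R h + \<rho> *\<^sub>R u"
  let ?D = "\<lambda>v w. g\<^sup>2 * (X \<bullet> w) * (cross3 u h \<bullet> v) - g * (cross3 u w \<bullet> v)"
  \<comment> \<open>The sign condition on \<open>u\<close> keeps \<open>\<rho> + c\<close> positive,
    that is, \<open>r\<close> off the Dirac string \<open>h = - \<rho> u\<close>.\<close>
  have pos: "0 < \<rho>" "0 \<le> c"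
    using assms by (auto simp: \<rho>_def h_def c_def inner_commute)
  then have ne: "\<rho> \<noteq> 0" "\<rho> + c \<noteq> 0"
    by auto
  have n: "((\<lambda>s. norm (r' - s)) has_derivative (\<lambda>v. - (h \<bullet> v) / \<rho>)) (at r)"
    using has_derivative_norm_diff[OF assms(1)] by (simp add: h_def \<rho>_def)
  define K where "K s = inverse (norm (r' - s) * (norm (r' - s) + u \<bullet> (r' - s)))" for s
  have "((\<lambda>s. norm (r' - s) * (norm (r' - s) + u \<bullet> (r' - s))) has_derivative (\<lambda>w. - (X \<bullet> w))) (at r)"
    using ne by (auto intro!: derivative_eq_intros n ext
        simp: X_def h_def \<rho>_def[unfolded h_def, symmetric] c_def algebra_simps inner_simps
          add_divide_distrib diff_divide_distrib)
  from Deriv.has_derivative_inverse[OF _ this]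
  have K: "(K has_derivative (\<lambda>w. g\<^sup>2 * (X \<bullet> w))) (at r)"
    using ne unfolding K_def
    by (auto elim!: has_derivative_eq_rhs
        simp: g_def h_def[symmetric] \<rho>_def[symmetric] c_def[symmetric] power2_eq_square mult_ac)
  have "((\<lambda>s. omega0_form u r' s v) has_derivative ?D v) (at r)" for v
  proof -
    \<comment> \<open>Cycling the triple product makes the numerator an inner product of a constant
      vector with \<open>r' - s\<close>.\<close>
    have swap: "cross3 v u \<bullet> z = cross3 u z \<bullet> v" for z
      by (simp add: cross3_def inner_vec_def sum_3 algebra_simps)
    have "(\<lambda>s. omega0_form u r' s v) = (\<lambda>s. K s * (cross3 v u \<bullet> (r' - s)))"
      by (simp add: omega0_form_def divide_inverse dr_form_def coord_form_def K_def swap mult.commute)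
    moreover have "((\<lambda>s. K s * (cross3 v u \<bullet> (r' - s))) has_derivative
       (\<lambda>w. K r * (cross3 v u \<bullet> (- w)) + g\<^sup>2 * (X \<bullet> w) * (cross3 v u \<bullet> h))) (at r)"
      unfolding h_def by (auto intro!: derivative_eq_intros K)
    moreover have "K r = g"
      by (simp add: K_def g_def h_def c_def \<rho>_def)
    ultimately show ?thesis
      by (simp add: swap algebra_simps)
  qed
  moreover have "?D w v - ?D v w = - (inverse \<rho> ^ 3 * (h \<bullet> cross3 v w))" for v w
  proof -
    let ?N = "cross3 v w"
    have hh: "h \<bullet> h = \<rho>\<^sup>2" and uu: "u \<bullet> u = 1"
      using assms(2) by (simp_all add: \<rho>_def power2_norm_eq_inner norm_eq_1)
    \<comment> \<open>These enter through \<open>X \<times> (u \<times> h) = (X \<bullet> h) u - (X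
      \<bullet> u) h\<close>.\<close>
    have Xh: "X \<bullet> h = 2 * (\<rho> * (\<rho> + c))" and Xu: "X \<bullet> u = (\<rho> + c)\<^sup>2 / \<rho>"
      using ne by (simp_all add: X_def inner_simps hh uu inner_commute[of h u] c_def[symmetric]
          power2_eq_square field_simps)
    have "(X \<bullet> v) * (cross3 u h \<bullet> w) - (X \<bullet> w) * (cross3 u h \<bullet> v) = cross3 X (cross3 u h) \<bullet> ?N"
      by (simp add: dot_cross)
    also have "\<dots> = 2 * (\<rho> * (\<rho> + c)) * (u \<bullet> ?N) - (\<rho> + c)\<^sup>2 / \<rho> * (h \<bullet> ?N)"
      by (simp add: Lagrange inner_diff_left Xh Xu)
    finally have X: "(X \<bullet> v) * (cross3 u h \<bullet> w) - (X \<bullet> w) * (cross3 u h \<bullet> v) =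
       2 * (\<rho> * (\<rho> + c)) * (u \<bullet> ?N) - (\<rho> + c)\<^sup>2 / \<rho> * (h \<bullet> ?N)" .
    have "cross3 u v \<bullet> w = u \<bullet> ?N" "cross3 u w \<bullet> v = - (u \<bullet> ?N)"
      by (simp_all add: cross3_def inner_vec_def sum_3 algebra_simps)
    then have D: "?D w v - ?D v w = g\<^sup>2 * ((X \<bullet> v) * (cross3 u h \<bullet> w) - (X \<bullet> w) * (cross3 u h \<bullet> v)) - 2 * g * (u \<bullet> ?N)"
      by (simp add: algebra_simps)
    \<comment> \<open>With \<open>x = \<rho>\<close> and \<open>d = \<rho> + c\<close>: the terms
      along \<open>u\<close> cancel, and \<open>d\<^sup>2\<close> cancels against the squared
      denominator, leaving the Coulomb field.\<close>
    have key: "(inverse (x * d))\<^sup>2 * (2 * (x * d) * a - d\<^sup>2 / x * b) - 2 * inverse (x * d) * a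
      = - (inverse x ^ 3 * b)" if "x \<noteq> 0" "d \<noteq> 0" for x d a b :: real
      using that by (simp add: field_simps power2_eq_square power3_eq_cube)
    note D
    also have "g\<^sup>2 * ((X \<bullet> v) * (cross3 u h \<bullet> w) - (X \<bullet> w) * (cross3 u h \<bullet> v)) - 2 * g * (u \<bullet> ?N)
       = - (inverse \<rho> ^ 3 * (h \<bullet> cross3 v w))"
      unfolding X g_def
      using key[OF ne, of "u \<bullet> ?N" "h \<bullet> ?N"] by simp
    finally show ?thesis .
  qed
  ultimately show ?thesis
    unfolding h_def \<rho>_def by (rule has_ext_deriv1I)
qed

lemma grad_Green:
  assumes "r \<noteq> r'"
  shows "grad (Green r') r = (inverse (norm (r' - r)) ^ 3 / (4 * pi)) *\<^sub>R (r' - r)"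
proof -
  have G: "Green r' = (\<lambda>s. inverse (norm (r' - s)) * (1 / (4 * pi)))"
    by (rule ext) (simp add: Green_def field_simps)
  have "(Green r' has_derivative (\<lambda>v. ((r' - r) \<bullet> v) * inverse (norm (r' - r)) ^ 3 * (1 / (4 * pi)))) (at r)"
    unfolding G by (rule has_derivative_mult_left[OF has_derivative_inverse_dist[OF assms]])
  note frechet_derivative_at[OF this, symmetric]
  then show ?thesis
    by (simp add: grad_def vec_eq_iff inner_axis)
qed

section \<open>The potential of the form beta\<close>

lemma has_derivative_vec:
  fixes f :: "'a::real_normed_vector \<Rightarrow> 'b::euclidean_space^'n"
  assumes "\<And>i. ((\<lambda>s. f s $ i) has_derivative (\<lambda>v. f' v $ i)) (at r)"
  shows "(f has_derivative f') (at r)"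
proof (subst has_derivative_componentwise_within, rule ballI)
  fix b :: "'b^'n"
  assume "b \<in> Basis"
  then obtain i c where b: "b = axis i c"
    by (auto simp: Basis_vec_def)
  show "((\<lambda>x. f x \<bullet> b) has_derivative (\<lambda>x. f' x \<bullet> b)) (at r)"
    unfolding b inner_axis by (rule has_derivative_inner_left[OF assms])
qed

text \<open>The double sum of \<open>beta_form\<close> with \<open>a = j - 2\<close>. The divisor
  \<open>Suc a = j - 1\<close> is left over from \<open>C_coeff\<close> and is cancelled by
  differentiating the power \<open>Suc a\<close>.\<close>

definition beta_potential :: "nat \<Rightarrow> int \<Rightarrow> real^3 \<Rightarrow> real^3 \<Rightarrow> complex^3" where
  "beta_potential l m r' s = (\<chi> i. harmonic_norm l m * of_nat l *
    (\<Sum>a<l - 1. coeff (null_poly (axis i 1) * null_poly r' ^ (l - 2 - a) * null_poly s ^ Suc a)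
      (nat (int l + m)) / of_nat (Suc a)))"

text \<open>The product of the two axis polynomials makes the matrix symmetric and, by isotropy,
  traceless; the other factor is a geometric sum.\<close>

definition beta_potential_jacobian :: "nat \<Rightarrow> int \<Rightarrow> real^3 \<Rightarrow> real^3 \<Rightarrow> complex^3^3" where
  "beta_potential_jacobian l m r' r = (\<chi> i k. harmonic_norm l m * of_nat l *
    coeff ((\<Sum>a<l - 1. null_poly r' ^ (l - 2 - a) * null_poly r ^ a) *
      (null_poly (axis i 1) * null_poly (axis k 1))) (nat (int l + m)))"

text \<open>With \<open>j = a + 2\<close>, the product of
  \<open>(j - 2)! (l - j)! / (l - 1)!\<close>, \<open>l! / (j! (l - j)!)\<close> and
  \<open>j\<close> collapses to \<open>l / (j - 1)\<close>. The factor \<open>j\<close> comes from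
  differentiating a power \<open>j\<close>.\<close>

lemma C_coeff_binomial:
  assumes "a + 2 \<le> l"
  shows "C_coeff (a + 2) l * real (l choose (a + 2)) * real (a + 2) = real l / real (Suc a)"
proof -
  obtain b where l: "l = a + 2 + b"
    using assms le_iff_add by blast
  have quot: "C * B * y = x / z"
    if "C = f * g / F" "B = G / (A * g)" "G = x * F" "A = y * (z * f)"
      "f \<noteq> 0" "g \<noteq> 0" "F \<noteq> 0" "y \<noteq> 0" for A B C F G f g x y z :: real
    using that by simp
  have "C_coeff (a + 2) l = fact a * fact b / fact (a + b + 1)"
    using assms by (subst C_coeff_eq) (simp_all add: l)
  moreover have "real (l choose (a + 2)) = fact l / (fact (a + 2) * fact b)"
    using binomial_fact[of "a + 2" l, where 'a = real] by (simp add: l)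
  moreover have "fact l = real l * fact (a + b + 1)"
    using fact_Suc[of "a + b + 1", where 'a = real] by (simp add: l del: fact_Suc)
  moreover have "fact (a + 2) = real (a + 2) * (real (Suc a) * fact a)"
    using fact_Suc[of "Suc a", where 'a = real] fact_Suc[of a, where 'a = real] by (simp del: fact_Suc)
  ultimately show ?thesis
    by (rule quot) simp_all
qed

lemma of_nat_mult_poly: "of_nat k * p = smult (of_nat k) p" for p :: "'a::comm_semiring_1 poly"
  by (simp add: of_nat_poly)

lemma sum_C_coeff_grad_solid_S:
  assumes "\<bar>m\<bar> \<le> int l"
  shows "(\<Sum>j = 2..l. complex_of_real (C_coeff j l) *s
      (\<Sum>k = - int j..int j. (solid_S (l - j) (m - k) r' * complex_of_real (T_coeff j k l m)) *s
        grad (solid_S j k) s)) = beta_potential l m r' s" (is "?L = _")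
proof -
  let ?n = "nat (int l + m)"
  have "?L $ i = beta_potential l m r' s $ i" for i
  proof -
    let ?p = "\<lambda>a. coeff (null_poly (axis i 1) * null_poly r' ^ (l - 2 - a) * null_poly s ^ Suc a) ?n"
    have "?L $ i = (\<Sum>j = 2..l. C_coeff j l * (harmonic_norm l m * (l choose j) *
        coeff (of_nat j * null_poly s ^ (j - 1) * null_poly (axis i 1) * null_poly r' ^ (l - j)) ?n))"
      using assms by (simp add: sum_solid_S_grad del: of_real_of_nat_eq of_nat_Suc)
    also have "\<dots> = (\<Sum>a<l - 1. C_coeff (a + 2) l * (harmonic_norm l m * (l choose (a + 2)) *
        coeff (of_nat (a + 2) * null_poly s ^ (a + 2 - 1) * null_poly (axis i 1) * null_poly r' ^ (l - (a + 2))) ?n))"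
    proof (rule sum.reindex_cong)
      show "inj_on (\<lambda>a. a + 2) {..<l - 1}"
        by (simp add: inj_on_def)
      show "{2..l} = (\<lambda>a. a + 2) ` {..<l - 1}"
        using image_add_atLeastLessThan'[of 2 0 "l - 1"] by (auto simp: lessThan_atLeast0)
    qed (rule refl)
    also have "\<dots> = (\<Sum>a<l - 1. harmonic_norm l m * of_nat l * (?p a / of_nat (Suc a)))"
    proof (rule sum.cong[OF refl])
      fix a assume "a \<in> {..<l - 1}"
      then have "complex_of_real (C_coeff (a + 2) l * (l choose (a + 2)) * (a + 2)) = of_real (l / Suc a)"
        by (subst C_coeff_binomial) auto
      then have C: "complex_of_real (C_coeff (a + 2) l) * of_nat (l choose (a + 2)) * of_nat (a + 2)
          = of_nat l / of_nat (Suc a)"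
        by (simp only: of_real_mult of_real_divide of_real_of_nat_eq)
      have p: "coeff (of_nat (a + 2) * null_poly s ^ (a + 2 - 1) * null_poly (axis i 1) * null_poly r' ^ (l - (a + 2))) ?n
         = of_nat (a + 2) * ?p a"
        unfolding mult.assoc of_nat_mult_poly coeff_smult by (simp add: mult_ac)
      have "of_real (C_coeff (a + 2) l) * (of_real (harmonic_norm l m) * of_nat (l choose (a + 2)) * (of_nat (a + 2) * ?p a)) =
        of_real (harmonic_norm l m) * (of_real (C_coeff (a + 2) l) * of_nat (l choose (a + 2)) * of_nat (a + 2)) * ?p a"
        by (simp only: mult_ac)
      then show "C_coeff (a + 2) l * (harmonic_norm l m * (l choose (a + 2)) *
          coeff (of_nat (a + 2) * null_poly s ^ (a + 2 - 1) * null_poly (axis i 1) * null_poly r' ^ (l - (a + 2))) ?n)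
        = harmonic_norm l m * of_nat l * (?p a / of_nat (Suc a))"
        unfolding p C of_real_mult of_real_of_nat_eq by simp
    qed
    finally show ?thesis
      by (simp add: beta_potential_def sum_distrib_left)
  qed
  then show ?thesis
    by (simp add: vec_eq_iff)
qed

text \<open>Every \<open>q_form\<close> has the same left factor, the differential of the unit
  vector, and complex scalars are central, so the double sum moves into the right factor.\<close>

lemma beta_form_eq:
  assumes "s \<noteq> r'" "\<bar>m\<bar> \<le> int l"
  shows "beta_form l m r' s v =
    (- 1 / (4 * pi)) *\<^sub>R (qvec (cvec (unit_deriv r' s v)) \<otimes>\<^sub>q qvec (beta_potential l m r' s))"
proof -
  let ?P = "qvec (cvec (unit_deriv r' s v))"
  have q: "c *\<^sub>q q_form j k r' s v = - (?P \<otimes>\<^sub>q qvec (c *s grad (solid_S j k) s))" for c j k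
  proof -
    have "c *\<^sub>q - f = - (c *\<^sub>q f)" for f
      by (simp add: qscale_def vec_eq_iff)
    then show ?thesis
      by (simp add: q_form_def ext_deriv0_unit[OF assms(1)] qscale_qmult_qvec)
  qed
  have neg: "c *\<^sub>q - (?P \<otimes>\<^sub>q qvec b) = - (?P \<otimes>\<^sub>q qvec (c *s b))" for c b
    by (simp add: qscale_qmult_qvec[symmetric] qscale_def vec_eq_iff)
  have "beta_form l m r' s v = complex_of_real (1 / (4 * pi)) *\<^sub>q - (?P \<otimes>\<^sub>q qvec
    (\<Sum>j = 2..l. complex_of_real (C_coeff j l) *s
      (\<Sum>k = - int j..int j. (solid_S (l - j) (m - k) r' * complex_of_real (T_coeff j k l m)) *s
        grad (solid_S j k) s)))"
    unfolding beta_form_def q sum_negf qmult.sum_right[symmetric] qvec_sum[symmetric] neg ..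
  then show ?thesis
    unfolding sum_C_coeff_grad_solid_S[OF assms(2)] qscale_of_real by simp
qed

lemma has_derivative_beta_potential:
  "(beta_potential l m r' has_derivative (\<lambda>v. beta_potential_jacobian l m r' r *v cvec v)) (at r)"
proof (rule has_derivative_vec)
  fix i :: 3
  let ?n = "nat (int l + m)" and ?e = "\<lambda>i. null_poly (axis i 1)"
  let ?G = "\<Sum>a<l - 1. null_poly r' ^ (l - 2 - a) * null_poly r ^ a"
  \<comment> \<open>Linearity contracts the sum over \<open>k\<close> to \<open>null_poly v\<close>;
    inserting \<open>Suc a / Suc a\<close> gives each term the shape of a derivative of a
    power.\<close>
  have J: "(beta_potential_jacobian l m r' r *v cvec v) $ i = harmonic_norm l m * of_nat l *
      (\<Sum>a<l - 1. coeff (of_nat (Suc a) * (?e i * null_poly r' ^ (l - 2 - a)) * null_poly r ^ (Suc a - 1) * null_poly v) ?n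
        / of_nat (Suc a))" for v
  proof -
    have "(beta_potential_jacobian l m r' r *v cvec v) $ i =
      (\<Sum>k\<in>UNIV. harmonic_norm l m * of_nat l * coeff (?G * (?e i * smult (of_real (v$k)) (?e k))) ?n)"
      by (simp add: matrix_vector_mult_def beta_potential_jacobian_def cvec_def mult_ac)
    also have "\<dots> = harmonic_norm l m * of_nat l * coeff (?G * (?e i * null_poly v)) ?n"
      unfolding null_poly_sum_axis[of v] sum_distrib_left coeff_sum ..
    also have "coeff (?G * (?e i * null_poly v)) ?n = (\<Sum>a<l - 1. coeff (null_poly r' ^ (l - 2 - a) * null_poly r ^ a * (?e i * null_poly v)) ?n)"
      by (simp add: sum_distrib_right coeff_sum)
    also have "\<dots> = (\<Sum>a<l - 1. coeff (of_nat (Suc a) * (?e i * null_poly r' ^ (l - 2 - a)) * null_poly r ^ (Suc a - 1) * null_poly v) ?n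
        / of_nat (Suc a))"
      unfolding mult.assoc[of "of_nat _"] of_nat_mult_poly coeff_smult
      by (intro sum.cong refl) (simp add: mult_ac del: of_nat_Suc)
    finally show ?thesis .
  qed
  show "((\<lambda>s. beta_potential l m r' s $ i) has_derivative
      (\<lambda>v. (beta_potential_jacobian l m r' r *v cvec v) $ i)) (at r)"
    unfolding J beta_potential_def vec_lambda_beta divide_inverse
    by (intro has_derivative_mult_right has_derivative_sum has_derivative_mult_left
        has_derivative_coeff_mult_null_poly_power)
qed

section \<open>Symmetry, trace and radial action of the Jacobian\<close>

lemma transpose_beta_potential_jacobian:
  "transpose (beta_potential_jacobian l m r' r) = beta_potential_jacobian l m r' r"
  by (simp add: transpose_def beta_potential_jacobian_def mult.commute)

lemma trace_beta_potential_jacobian: "trace (beta_potential_jacobian l m r' r) = 0"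
  unfolding trace_def beta_potential_jacobian_def vec_lambda_beta
    sum_distrib_left[symmetric] coeff_sum[symmetric] power2_eq_square[symmetric] null_poly_isotropic
  by simp

text \<open>A geometric sum: \<open>null_poly\<close> is linear, so multiplying by \<open>null_poly (r - r')\<close> telescopes.\<close>

lemma beta_potential_jacobian_radial:
  assumes "\<bar>m\<bar> \<le> int l" "1 \<le> l"
  shows "beta_potential_jacobian l m r' r *v cvec (r - r') = grad (solid_S l m) r - grad (solid_S l m) r'"
    (is "?L = ?R")
proof -
  let ?n = "nat (int l + m)" and ?e = "\<lambda>i. null_poly (axis i 1)"
  let ?G = "\<Sum>a<l - 1. null_poly r' ^ (l - 2 - a) * null_poly r ^ a"
  have geo: "null_poly (r - r') * ?G = null_poly r ^ (l - 1) - null_poly r' ^ (l - 1)"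
    by (simp add: null_poly_diff power_diff_sumr2 numeral_2_eq_2)
  have "?L $ i = ?R $ i" for i
  proof -
    have "?L $ i = (\<Sum>k\<in>UNIV. harmonic_norm l m * of_nat l * coeff (?G * (?e i * smult (of_real ((r - r')$k)) (?e k))) ?n)"
      by (simp add: matrix_vector_mult_def beta_potential_jacobian_def cvec_def mult_ac)
    also have "\<dots> = harmonic_norm l m * of_nat l * coeff (?G * (?e i * null_poly (r - r'))) ?n"
      unfolding null_poly_sum_axis[of "r - r'"] sum_distrib_left coeff_sum ..
    also have "?G * (?e i * null_poly (r - r')) = (null_poly r ^ (l - 1) - null_poly r' ^ (l - 1)) * ?e i"
      unfolding geo[symmetric] by (simp only: mult_ac)
    also have "harmonic_norm l m * of_nat l * coeff \<dots> ?n = ?R $ i"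
      unfolding vector_minus_component grad_solid_S[OF assms(1)] mult.assoc[of "of_nat l"] of_nat_mult_poly coeff_smult
      by (simp add: algebra_simps)
    finally show ?thesis .
  qed
  then show ?thesis
    by (simp add: vec_eq_iff)
qed

text \<open>As \<open>dA\<close> is closed, the Leibniz rule leaves only
  \<open>- dA \<and> (M dr)\<close>, whose sign cancels that of \<open>- 1 / (4 * pi)\<close>.
  \<open>qmult_sym_traceless\<close> then applies \<open>M\<close> to \<open>- h = r - r'\<close>,
  where the geometric sum evaluates it.\<close>

lemma has_ext_deriv1_beta_form:
  assumes "r \<noteq> r'" "\<bar>m\<bar> \<le> int l" "1 \<le> l"
  shows "has_ext_deriv1 (beta_form l m r') (\<lambda>v w. (inverse (norm (r' - r)) ^ 3 / (4 * pi)) *\<^sub>R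
    (qvec (cvec (r' - r)) \<otimes>\<^sub>q qvec (cvec (cross3 v w)) \<otimes>\<^sub>q
      qvec (grad (solid_S l m) r - grad (solid_S l m) r'))) r"
proof -
  define h N K M where "h = r' - r" and "N = inverse (norm h) ^ 3" and "K = - 1 / (4 * pi)"
    and "M = beta_potential_jacobian l m r' r"
  let ?q = "\<lambda>v. qvec (cvec v)"
  let ?F = "beta_potential l m r'"
  have h0: "h \<noteq> 0"
    using assms(1) by (simp add: h_def)
  have P: "has_ext_deriv1 (\<lambda>s v. ?q (unit_deriv r' s v)) (\<lambda>v w. ?q 0) r"
    by (rule has_ext_deriv1_linear[OF bounded_linear_compose[OF bounded_linear_qvec bounded_linear_cvec]
        has_ext_deriv1_unit_deriv[OF assms(1)]])
  have F: "((\<lambda>s. qvec (?F s)) has_derivative (\<lambda>v. qvec (M *v cvec v))) (at r)"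
    unfolding M_def by (rule bounded_linear.has_derivative[OF bounded_linear_qvec has_derivative_beta_potential])
  let ?E = "\<lambda>v w. ?q 0 \<otimes>\<^sub>q qvec (?F r) -
    (?q (unit_deriv r' r v) \<otimes>\<^sub>q qvec (M *v cvec w) - ?q (unit_deriv r' r w) \<otimes>\<^sub>q qvec (M *v cvec v))"
  have "has_ext_deriv1 (\<lambda>s v. K *\<^sub>R (?q (unit_deriv r' s v) \<otimes>\<^sub>q qvec (?F s))) (\<lambda>v w. K *\<^sub>R ?E v w) r"
    by (rule has_ext_deriv1_linear[OF bounded_linear_scaleR_right has_ext_deriv1_bilinear[OF bounded_bilinear_qmult P F]])
  then have "has_ext_deriv1 (beta_form l m r') (\<lambda>v w. K *\<^sub>R ?E v w) r"
    by (rule has_ext_deriv1_cong[where U = "- {r'}"])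
      (use assms in \<open>auto simp: beta_form_eq K_def\<close>)
  moreover have "K *\<^sub>R ?E v w = (N / (4 * pi)) *\<^sub>R
    (?q h \<otimes>\<^sub>q ?q (cross3 v w) \<otimes>\<^sub>q qvec (grad (solid_S l m) r - grad (solid_S l m) r'))" for v w
  proof -
    \<comment> \<open>This brings the differential of the unit vector to
      \<open>h \<times> (h \<times> v) / |h|^3\<close>, the shape required by
      \<open>qmult_sym_traceless\<close>.\<close>
    have u: "?q (unit_deriv r' r v) = N *\<^sub>R ?q ((h \<bullet> v) *\<^sub>R h - (h \<bullet> h) *\<^sub>R v)" for v
    proof -
      have "N * (h \<bullet> h) = inverse (norm h)"
        using h0 by (simp add: N_def dot_square_norm power2_eq_square power3_eq_cube field_simps)
      then have "unit_deriv r' r v = N *\<^sub>R ((h \<bullet> v) *\<^sub>R h - (h \<bullet> h) *\<^sub>R v)"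
        by (simp add: unit_deriv_def N_def h_def scaleR_right_diff_distrib)
      then show ?thesis
        by (simp only: cvec_scaleR qvec_scaleR)
    qed
    have "?E v w = - (N *\<^sub>R (?q ((h \<bullet> v) *\<^sub>R h - (h \<bullet> h) *\<^sub>R v) \<otimes>\<^sub>q qvec (M *v cvec w) -
      ?q ((h \<bullet> w) *\<^sub>R h - (h \<bullet> h) *\<^sub>R w) \<otimes>\<^sub>q qvec (M *v cvec v)))"
      unfolding u qmult.scaleR_left scaleR_right_diff_distrib
      by (simp only: cvec_0 qvec_0 qmult.zero_left diff_0)
    also have "\<dots> = - (N *\<^sub>R (?q h \<otimes>\<^sub>q ?q (cross3 v w) \<otimes>\<^sub>q qvec (M *v cvec (- h))))"
      unfolding M_def by (subst qmult_sym_traceless)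
        (simp_all add: transpose_beta_potential_jacobian trace_beta_potential_jacobian)
    also have "M *v cvec (- h) = grad (solid_S l m) r - grad (solid_S l m) r'"
      using beta_potential_jacobian_radial[OF assms(2,3)] by (simp add: h_def M_def)
    finally show ?thesis
      by (simp add: K_def)
  qed
  ultimately show ?thesis
    by (simp only: h_def N_def)
qed

text \<open>Right multiplication by the constant gradient at \<open>r'\<close> is linear and
  commutes with \<open>d\<close>. Up to \<open>|h|^(-3)\<close>, where \<open>h = r' - r\<close> and
  \<open>n = cross3 v w\<close>, the parts of \<open>omega_form\<close> have derivatives
  \<open>- (h \<bullet> n)\<close> and \<open>h \<times> n\<close>, the two parts of the product
  \<open>(0, h) (0, n)\<close>.\<close>

lemma has_ext_deriv1_gamma_form:
  assumes "r \<noteq> r'" "norm u = 1" "0 \<le> (r' - r) \<bullet> u"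
  shows "has_ext_deriv1 (gamma_form l m u r') (\<lambda>v w. (inverse (norm (r' - r)) ^ 3 / (4 * pi)) *\<^sub>R
    (qvec (cvec (r' - r)) \<otimes>\<^sub>q qvec (cvec (cross3 v w)) \<otimes>\<^sub>q qvec (grad (solid_S l m) r'))) r"
proof -
  let ?N = "inverse (norm (r' - r)) ^ 3"
  have "has_ext_deriv1 (omega_form u r') (\<lambda>v w. (of_real (- (?N * ((r' - r) \<bullet> cross3 v w))),
      cvec (?N *\<^sub>R cross3 (r' - r) (cross3 v w)))) r"
    unfolding omega_form_def
    by (intro has_ext_deriv1_Pair has_ext_deriv1_linear[OF bounded_linear_of_real]
        has_ext_deriv1_linear[OF bounded_linear_cvec] has_ext_deriv1_omega0_form
        has_ext_deriv1_omega_vec_form assms)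
  moreover have "(of_real (- (?N * ((r' - r) \<bullet> cross3 v w))), cvec (?N *\<^sub>R cross3 (r' - r) (cross3 v w)))
    = ?N *\<^sub>R (qvec (cvec (r' - r)) \<otimes>\<^sub>q qvec (cvec (cross3 v w)))" for v w
    by (simp add: qmult_qvec_cvec cvec_scaleR scaleR_conv_of_real[where 'a = complex])
  ultimately have "has_ext_deriv1 (omega_form u r')
     (\<lambda>v w. ?N *\<^sub>R (qvec (cvec (r' - r)) \<otimes>\<^sub>q qvec (cvec (cross3 v w)))) r"
    by simp
  from has_ext_deriv1_linear[OF bounded_linear_scaleR_right[of "1 / (4 * pi)"]
      has_ext_deriv1_linear[OF qmult.bounded_linear_left[of "qvec (grad (solid_S l m) r')"] this]]
  show ?thesis
    unfolding gamma_form_def qscale_of_real by (simp add: qmult.scaleR_left)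
qed

text \<open>Differentiability is asserted along with the identity because
  \<open>frechet_derivative\<close> is an unspecified value where no derivative exists. The kernel
  is singular at \<open>r'\<close>.\<close>

theorem theorem3p14:
  fixes S P :: "(real^3) set" and \<nu> :: "real^3 \<Rightarrow> real^3"
    and r' u :: "real^3" and l m :: nat
  assumes "smooth_oriented_surface S \<nu>"
    and "triangular_patch P S"
    and "1 \<le> m" and "m \<le> l"
    and "norm u = 1"
    and "\<And>r. r \<in> P \<Longrightarrow> (r' - r) \<bullet> u \<ge> 0"
  shows "\<forall>r\<in>P. r \<noteq> r' \<longrightarrow>
    form1_differentiable_at (\<lambda>s v. beta_form l (int m) r' s v + gamma_form l (int m) u r' s v) r \<and>
    ext_deriv1 (\<lambda>s v. beta_form l (int m) r' s v + gamma_form l (int m) u r' s v) r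
      = alpha_form l (int m) r' r"
proof (intro ballI impI)
  fix r assume r: "r \<in> P" "r \<noteq> r'"
  let ?\<beta> = "\<lambda>s v. beta_form l (int m) r' s v + gamma_form l (int m) u r' s v"
  let ?c = "inverse (norm (r' - r)) ^ 3 / (4 * pi)"
  have ml: "\<bar>int m\<bar> \<le> int l" "1 \<le> l"
    using assms(3,4) by auto
  let ?E = "\<lambda>v w. ?c *\<^sub>R (qvec (cvec (r' - r)) \<otimes>\<^sub>q qvec (cvec (cross3 v w)) \<otimes>\<^sub>q
      qvec (grad (solid_S l m) r - grad (solid_S l m) r')) +
    ?c *\<^sub>R (qvec (cvec (r' - r)) \<otimes>\<^sub>q qvec (cvec (cross3 v w)) \<otimes>\<^sub>q qvec (grad (solid_S l m) r'))"
  have d: "has_ext_deriv1 ?\<beta> ?E r"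
    by (rule has_ext_deriv1_add[OF has_ext_deriv1_beta_form[OF r(2) ml]
          has_ext_deriv1_gamma_form[OF r(2) assms(5) assms(6)[OF r(1)]]])
  \<comment> \<open>By additivity in the last factor the gradients at \<open>r'\<close> cancel, and
    \<open>?c *\<^sub>R (r' - r)\<close> is the gradient of \<open>Green r'\<close>.\<close>
  have "?E = alpha_form l (int m) r' r"
    by (intro ext) (simp add: alpha_form_def grad_Green[OF r(2)] nu_da_eq_cross3 cvec_scaleR qvec_scaleR
        qmult.scaleR_left qvec_diff qmult.diff_right flip: scaleR_add_right)
  then show "form1_differentiable_at ?\<beta> r \<and> ext_deriv1 ?\<beta> r = alpha_form l (int m) r' r"
    using has_ext_deriv1D[OF d] by simp
qed

end
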